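(* Let $\Lambda=\{\lambda_k\}_1^\infty$ be a real sequence and $r>0$. Let $X$ be the sequence $X=\{x_k:=(0,0,\lambda_k)\}_{k=1}^\infty$ in $\mathbb{R}^3$ and let $f_r(x):=\Omega_3(r|x|)$, $x\in\mathbb{R}^3$, where $\Omega_3(t)=\frac{\sin t}{t}$ (with $\Omega_3(0)=1$). (i) If $d_*(\Lambda)>0$ and $D^*(\Lambda)<r/\pi$, then the function $f_r$ is strongly $X$-positive definite. (ii) If $f_r$ is strongly $X$-positive definite, then $d_*(\Lambda)>0$ and $D^*(\Lambda)\le r/\pi$.
   Context: For a real sequence $\Lambda=\{\lambda_k\}$: $d_*(\Lambda)=\inf_{k\ne j}|\lambda_k-\lambda_j|$; with $n(\rho)$ the largest number of points $\lambda_k$ contained in an interval of length $\rho$, the upper density is $D^*(\Lambda)=\lim_{\rho\to+\infty}n(\rho)/\rho$. A positive definite function $g$ on $\mathbb{R}^n$ is strongly $X$-positive definite for a sequence $X=\{x_k\}_1^\infty$ in $\mathbb{R}^n$ if there is $c>0$ such that $\sum_{k,j=1}^m\xi_k\overline{\xi_j}g(x_k-x_j)\ge c\sum_{k=1}^m|\xi_k|^2$ for all $m\in\mathbb{N}$ and $\xi_1,\dots,\xi_m\in\mathbb{C}$. *)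

theory Defs
  imports "HOL-Analysis.Analysis" "HOL-Library.Complex_Order" "HOL-Library.Extended_Nat"
begin

text \<open>
  Sequences are functions on \<^typ>\<open>nat\<close>, so the sequence \<open>\<lambda>\<^sub>1, \<lambda>\<^sub>2, \<dots>\<close> is \<open>\<Lambda> 0, \<Lambda> 1, \<dots>\<close> here.
\<close>

definition separation :: "(nat \<Rightarrow> real) \<Rightarrow> real" where
  "separation \<Lambda> = Inf {\<bar>\<Lambda> k - \<Lambda> j\<bar> | k j. k \<noteq> j}"

text \<open>
  Points are counted with multiplicity (by index), and the count is \<open>\<infinity>\<close> if infinitely many lie
  in the set; \<^const>\<open>card\<close> alone would give \<open>0\<close> there.
\<close>

definition num_points :: "(nat \<Rightarrow> real) \<Rightarrow> real set \<Rightarrow> enat" where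
  "num_points \<Lambda> I = (if finite {k. \<Lambda> k \<in> I} then enat (card {k. \<Lambda> k \<in> I}) else \<infinity>)"

text \<open>
  Among the intervals of length \<open>\<rho>\<close> with given end points the closed one contains the most points.
  A supremum of values in \<^typ>\<open>enat\<close> is attained unless it is \<open>\<infinity>\<close>.
\<close>

definition max_num_points :: "(nat \<Rightarrow> real) \<Rightarrow> real \<Rightarrow> enat" where
  "max_num_points \<Lambda> \<rho> = (SUP a. num_points \<Lambda> {a..a + \<rho>})"

text \<open>
  The limit always exists in \<^typ>\<open>ereal\<close>: \<^term>\<open>max_num_points \<Lambda>\<close> is either finite and subadditive on
  the positive reals, or \<open>\<infinity>\<close> at every positive length.
\<close>

definition upper_density :: "(nat \<Rightarrow> real) \<Rightarrow> ereal" where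
  "upper_density \<Lambda> = Lim at_top (\<lambda>\<rho>. ereal_of_enat (max_num_points \<Lambda> \<rho>) / ereal \<rho>)"

text \<open>
  The order on \<^typ>\<open>complex\<close> is the one of \<^theory>\<open>HOL-Library.Complex_Order\<close>: \<open>z \<le> w\<close> means that
  \<open>w - z\<close> is a nonnegative real number.
\<close>

definition positive_definite :: "(real ^ 'n \<Rightarrow> complex) \<Rightarrow> bool" where
  "positive_definite g \<longleftrightarrow>
     (\<forall>(m::nat) (x :: nat \<Rightarrow> real ^ 'n) (\<xi> :: nat \<Rightarrow> complex).
        0 \<le> (\<Sum>k<m. \<Sum>j<m. \<xi> k * cnj (\<xi> j) * g (x k - x j)))"

definition strongly_positive_definite ::
    "(nat \<Rightarrow> real ^ 'n) \<Rightarrow> (real ^ 'n \<Rightarrow> complex) \<Rightarrow> bool" where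
  "strongly_positive_definite X g \<longleftrightarrow>
     positive_definite g \<and>
     (\<exists>c::real. c > 0 \<and>
       (\<forall>(m::nat) (\<xi> :: nat \<Rightarrow> complex).
          complex_of_real (c * (\<Sum>k<m. (cmod (\<xi> k))\<^sup>2))
            \<le> (\<Sum>k<m. \<Sum>j<m. \<xi> k * cnj (\<xi> j) * g (X k - X j))))"

definition Omega3 :: "real \<Rightarrow> real" where
  "Omega3 t = (if t = 0 then 1 else sin t / t)"

end

theory Submission
  imports Defs
begin

text \<open>
  After rescaling to \<open>\<mu>\<^sub>k = r \<lambda>\<^sub>k / \<pi>\<close> the form is the Gram form of the functions \<open>s(\<cdot> - \<mu>\<^sub>k)\<close>,
  \<open>s(x) = sin (\<pi>x) / (\<pi>x)\<close>, whose integer translates are orthonormal. Positive definiteness of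
  \<open>f\<^sub>r\<close> on the whole space holds because \<open>sin |x| / |x|\<close> is the mean of \<open>cos (x \<cdot> \<omega>)\<close> over the
  unit sphere.

  (i) If every interval of some integer length \<open>L\<close> contains fewer than \<open>L\<close> of the \<open>\<mu>\<^sub>k\<close>, then for each
  \<open>k\<close> one can replace integer zeros of \<open>sin (\<pi>x)\<close> by the points \<open>\<mu>\<^sub>j\<close>, \<open>j \<noteq> k\<close>, moving each zero by at
  most \<open>L\<close>, and delete arbitrarily many further zeros near \<open>\<mu>\<^sub>k\<close>. The displaced zeros cost a factor
  of polynomial growth, the deleted ones pay for it, so that a finite combination \<open>F\<^sub>k\<close> of integer
  translates of \<open>s\<close> results with \<open>F\<^sub>k(\<mu>\<^sub>j) = \<delta>\<^sub>j\<^sub>k\<close> and coefficients decaying quadratically away from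
  \<open>\<mu>\<^sub>k\<close>, uniformly in \<open>k\<close> and in the number of points. Schur's test and duality give the lower bound.

  (ii) The density bound is the comparison argument of Ramanathan and Steger: the span of the
  \<open>s(\<cdot> - \<mu>\<^sub>k)\<close> with \<open>\<mu>\<^sub>k\<close> in an interval lies up to a small error in the span of the integer translates
  from a slightly longer interval, and the trace of the product of the two projections is at most the
  number of these integers.
\<close>

section \<open>Positive definiteness of the sinc function on three-space\<close>

definition sphere_box :: "(real \<times> real) set" where
  "sphere_box = cbox (0, 0) (pi, 2 * pi)"

text \<open>The inner product of \<open>(a, b, c)\<close> with the unit vector whose polar angle is
  \<open>fst t\<close> and whose azimuth is \<open>snd t\<close>.\<close>

definition sphere_dir :: "real \<Rightarrow> real \<Rightarrow> real \<Rightarrow> real \<times> real \<Rightarrow> real" where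
  "sphere_dir a b c t =
     a * (sin (fst t) * cos (snd t)) + b * (sin (fst t) * sin (snd t)) + c * cos (fst t)"

text \<open>The surface integral of a plane wave: \<open>sin (fst t)\<close> is the density of the
  sphere, whose total mass is \<open>4 * pi\<close>.\<close>

definition sphere_cos :: "real \<Rightarrow> real \<Rightarrow> real \<Rightarrow> real" where
  "sphere_cos a b c = integral sphere_box (\<lambda>t. cos (sphere_dir a b c t) * sin (fst t))"

text \<open>By Fubini the inner integral is the increment of \<open>g\<close> over a full turn of
  the azimuth.\<close>

lemma integral_snd_derivative_eq_0:
  fixes g g' :: "real \<times> real \<Rightarrow> real"
  assumes deriv: "\<And>u v. ((\<lambda>v. g (u, v)) has_real_derivative g' (u, v)) (at v)"
    and cont: "continuous_on sphere_box g'"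
    and bdry: "\<And>u. g (u, 2 * pi) = g (u, 0)"
  shows "integral sphere_box g' = 0"
proof -
  have *: "integral {0..2 * pi} (\<lambda>v. g' (u, v)) = 0" for u
  proof -
    have "((\<lambda>v. g' (u, v)) has_integral (g (u, 2 * pi) - g (u, 0))) {0..2 * pi}"
      using deriv by (intro fundamental_theorem_of_calculus)
        (auto simp: has_real_derivative_iff_has_vector_derivative [symmetric]
           intro: has_field_derivative_at_within)
    then show ?thesis
      by (simp add: bdry integral_unique)
  qed
  have "integral sphere_box g' = integral {0..pi} (\<lambda>u. integral {0..2 * pi} (\<lambda>v. g' (u, v)))"
    using integral_prod_continuous[of 0 0 pi "2 * pi" g'] cont
    by (simp add: sphere_box_def case_prod_unfold)
  then show ?thesis
    by (simp add: *)
qed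

lemma integral_fst_derivative_eq_0:
  fixes g g' :: "real \<times> real \<Rightarrow> real"
  assumes deriv: "\<And>u v. ((\<lambda>u. g (u, v)) has_real_derivative g' (u, v)) (at u)"
    and cont: "continuous_on sphere_box g'"
    and bdry: "\<And>v. g (pi, v) = g (0, v)"
  shows "integral sphere_box g' = 0"
proof -
  have *: "integral {0..pi} (\<lambda>u. g' (u, v)) = 0" for v
  proof -
    have "((\<lambda>u. g' (u, v)) has_integral (g (pi, v) - g (0, v))) {0..pi}"
      using deriv by (intro fundamental_theorem_of_calculus)
        (auto simp: has_real_derivative_iff_has_vector_derivative [symmetric]
           intro: has_field_derivative_at_within)
    then show ?thesis
      by (simp add: bdry integral_unique)
  qed
  have "integral sphere_box g' = integral {0..pi} (\<lambda>u. integral {0..2 * pi} (\<lambda>v. g' (u, v)))"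
    using integral_prod_continuous[of 0 0 pi "2 * pi" g'] cont
    by (simp add: sphere_box_def case_prod_unfold)
  also have "\<dots> = integral {0..2 * pi} (\<lambda>v. integral {0..pi} (\<lambda>u. g' (u, v)))"
    using integral_swap_continuous[of 0 0 pi "2 * pi" "\<lambda>u v. g' (u, v)"] cont
    by (simp add: sphere_box_def case_prod_unfold)
  finally show ?thesis
    by (simp add: *)
qed

text \<open>Differentiation under the integral sign. As \<open>sphere_dir\<close> is linear in its
  coefficients, the derivative of the phase is \<open>sphere_dir\<close> of the derivatives.\<close>

lemma sphere_cos_has_derivative:
  fixes a b c :: "real \<Rightarrow> real"
  assumes [derivative_intros]: "\<And>t. (a has_real_derivative a' t) (at t)"
    "\<And>t. (b has_real_derivative b' t) (at t)" "\<And>t. (c has_real_derivative c' t) (at t)"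
    and [continuous_intros]: "continuous_on UNIV a'" "continuous_on UNIV b'" "continuous_on UNIV c'"
  shows "((\<lambda>t. sphere_cos (a t) (b t) (c t)) has_real_derivative
     integral sphere_box (\<lambda>y. - sin (sphere_dir (a t) (b t) (c t) y) *
        sphere_dir (a' t) (b' t) (c' t) y * sin (fst y))) (at t)"
proof -
  have [continuous_intros]: "continuous_on UNIV a" "continuous_on UNIV b" "continuous_on UNIV c"
    using assms(1-3) by (auto simp: continuous_on_eq_continuous_at intro: DERIV_isCont)
  note [continuous_intros] = continuous_on_compose2[OF \<open>continuous_on UNIV a\<close>]
    continuous_on_compose2[OF \<open>continuous_on UNIV b\<close>] continuous_on_compose2[OF \<open>continuous_on UNIV c\<close>]
    continuous_on_compose2[OF \<open>continuous_on UNIV a'\<close>]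
    continuous_on_compose2[OF \<open>continuous_on UNIV b'\<close>] continuous_on_compose2[OF \<open>continuous_on UNIV c'\<close>]
  show ?thesis
    unfolding sphere_cos_def sphere_box_def sphere_dir_def
    by (rule leibniz_rule_field_derivative[where U = UNIV])
      (auto intro!: derivative_eq_intros continuous_intros integrable_continuous
         simp: case_prod_unfold algebra_simps)
qed

lemma sphere_cos_rotate12:
  "sphere_cos (a * cos t - b * sin t) (a * sin t + b * cos t) c = sphere_cos a b c"
proof -
  define A where "A t = a * cos t - b * sin t" for t
  define B where "B t = a * sin t + b * cos t" for t
  have "((\<lambda>t. sphere_cos (A t) (B t) c) has_real_derivative 0) (at t)" for t
  proof -
    define p where "p = sphere_dir (A t) (B t) c"
    have "((\<lambda>t. sphere_cos (A t) (B t) c) has_real_derivative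
      integral sphere_box (\<lambda>y. - sin (p y) * sphere_dir (- B t) (A t) 0 y * sin (fst y))) (at t)"
      unfolding p_def
      by (rule sphere_cos_has_derivative)
        (auto simp: A_def B_def intro!: derivative_eq_intros continuous_intros)
    \<comment> \<open>The phase derivative \<open>sphere_dir (- B t) (A t) 0\<close> is minus the
      azimuth derivative of \<open>p\<close>, so the integrand is an exact azimuth
      derivative.\<close>
    also have "integral sphere_box (\<lambda>y. - sin (p y) * sphere_dir (- B t) (A t) 0 y * sin (fst y)) = 0"
      by (rule integral_snd_derivative_eq_0[where g = "\<lambda>y. - cos (p y) * sin (fst y)"])
        (auto simp: p_def sphere_dir_def sphere_box_def algebra_simps
           intro!: derivative_eq_intros continuous_intros)
    finally show ?thesis .
  qed
  then have "sphere_cos (A t) (B t) c = sphere_cos (A 0) (B 0) c"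
    using DERIV_isconst_all by blast
  then show ?thesis
    by (simp add: A_def B_def)
qed

text \<open>This rotation moves the poles, so its generator mixes polar and azimuthal derivatives
  and the integrand is exact only as a divergence.\<close>

lemma sphere_cos_rotate13:
  "sphere_cos (a * cos t - c * sin t) b (a * sin t + c * cos t) = sphere_cos a b c"
proof -
  define A where "A t = a * cos t - c * sin t" for t
  define C where "C t = a * sin t + c * cos t" for t
  have "((\<lambda>t. sphere_cos (A t) b (C t)) has_real_derivative 0) (at t)" for t
  proof -
    define p where "p = sphere_dir (A t) b (C t)"
    \<comment> \<open>The derivative in \<open>t\<close> of the integrand is the divergence of a vector field that has no flux
      through the boundary of the box; \<open>g'\<close> and \<open>h'\<close> are the two summands of this divergence.\<close>
    define g' where "g' y = - sin (p y) * (A t * cos (fst y) * cos (snd y)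
      + b * cos (fst y) * sin (snd y) - C t * sin (fst y)) * (sin (fst y) * cos (snd y))
      + cos (p y) * (cos (fst y) * cos (snd y))" for y
    define h' where "h' y = - sin (p y) * (b * sin (fst y) * cos (snd y)
      - A t * sin (fst y) * sin (snd y)) * (- cos (fst y) * sin (snd y))
      - cos (p y) * (cos (fst y) * cos (snd y))" for y
    have cont: "continuous_on sphere_box g'" "continuous_on sphere_box h'"
      unfolding g'_def h'_def p_def sphere_dir_def by (auto intro!: continuous_intros)
    \<comment> \<open>The boundary terms vanish because \<open>sin (fst y)\<close> is zero at both
      poles.\<close>
    have 1: "integral sphere_box g' = 0"
      by (rule integral_fst_derivative_eq_0
            [where g = "\<lambda>y. cos (p y) * (sin (fst y) * cos (snd y))", OF _ cont(1)])
        (auto simp: p_def sphere_dir_def g'_def algebra_simps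
           intro!: derivative_eq_intros)
    have 2: "integral sphere_box h' = 0"
      by (rule integral_snd_derivative_eq_0
            [where g = "\<lambda>y. cos (p y) * (- cos (fst y) * sin (snd y))", OF _ cont(2)])
        (auto simp: p_def sphere_dir_def h'_def algebra_simps
           intro!: derivative_eq_intros)
    \<comment> \<open>The cosine terms of \<open>g'\<close> and \<open>h'\<close> cancel; the
      Pythagorean identity in the azimuth collapses the rest.\<close>
    have "g' y + h' y = - sin (p y) * sphere_dir (- C t) 0 (A t) y * sin (fst y)" for y
    proof -
      have "cos (snd y) * cos (snd y) = 1 - sin (snd y) * sin (snd y)"
        using sin_cos_squared_add3[of "snd y"] by linarith
      then have *: "cos (snd y) * (cos (snd y) * z) = z - sin (snd y) * (sin (snd y) * z)" for z
        by (simp add: mult.assoc [symmetric] left_diff_distrib)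
      show ?thesis
        unfolding g'_def h'_def sphere_dir_def
        by (simp add: algebra_simps *)
    qed
    then have "integral sphere_box (\<lambda>y. - sin (p y) * sphere_dir (- C t) 0 (A t) y * sin (fst y)) =
      integral sphere_box (\<lambda>y. g' y + h' y)"
      by simp
    also have "\<dots> = integral sphere_box g' + integral sphere_box h'"
      using cont unfolding sphere_box_def by (intro integral_add integrable_continuous)
    finally have "integral sphere_box
        (\<lambda>y. - sin (p y) * sphere_dir (- C t) 0 (A t) y * sin (fst y)) = 0"
      using 1 2 by simp
    moreover have "((\<lambda>t. sphere_cos (A t) b (C t)) has_real_derivative
      integral sphere_box (\<lambda>y. - sin (p y) * sphere_dir (- C t) 0 (A t) y * sin (fst y))) (at t)"
      unfolding p_def
      by (rule sphere_cos_has_derivative)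
        (auto simp: A_def C_def intro!: derivative_eq_intros continuous_intros)
    ultimately show ?thesis by simp
  qed
  then have "sphere_cos (A t) b (C t) = sphere_cos (A 0) b (C 0)"
    using DERIV_isconst_all by blast
  then show ?thesis
    by (simp add: A_def C_def)
qed

text \<open>On the axis the wave depends on the polar angle alone, and for
  \<open>c \<noteq> 0\<close> the integrand has the primitive
  \<open>- sin (c * cos u) / c\<close>.\<close>

lemma sphere_cos_axis: "sphere_cos 0 0 c = 4 * pi * Omega3 c"
proof -
  have "sphere_cos 0 0 c = integral {0..pi} (\<lambda>u. integral {0..2 * pi} (\<lambda>v. cos (c * cos u) * sin u))"
    using integral_prod_continuous[of 0 0 pi "2 * pi" "\<lambda>(u, v). cos (c * cos u) * sin u"]
    by (simp add: sphere_cos_def sphere_dir_def sphere_box_def case_prod_unfold continuous_intros)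
  also have "(\<lambda>u. integral {0..2 * pi} (\<lambda>v. cos (c * cos u) * sin u)) =
      (\<lambda>u. 2 * pi * (cos (c * cos u) * sin u))"
    by (simp add: mult_ac)
  also have "integral {0..pi} \<dots> = 2 * pi * integral {0..pi} (\<lambda>u. cos (c * cos u) * sin u)"
    by (rule integral_mult_right)
  also have "integral {0..pi} (\<lambda>u. cos (c * cos u) * sin u) = 2 * Omega3 c"
  proof (cases "c = 0")
    case True
    have "((\<lambda>u. sin u) has_integral (- cos pi - - cos 0)) {0..pi}"
      by (intro fundamental_theorem_of_calculus)
        (auto simp: has_real_derivative_iff_has_vector_derivative [symmetric]
           intro!: derivative_eq_intros)
    with True show ?thesis
      by (simp add: Omega3_def integral_unique)
  next
    case False
    have "((\<lambda>u. cos (c * cos u) * sin u) has_integral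
        (- sin (c * cos pi) / c - - sin (c * cos 0) / c)) {0..pi}"
      using False by (intro fundamental_theorem_of_calculus)
        (auto simp: has_real_derivative_iff_has_vector_derivative [symmetric]
           intro!: derivative_eq_intros)
    with False show ?thesis
      by (simp add: Omega3_def integral_unique)
  qed
  finally show ?thesis by simp
qed

lemma Omega3_abs: "Omega3 \<bar>t\<bar> = Omega3 t"
  by (simp add: Omega3_def abs_if)

text \<open>Two rotations move \<open>(a, b, c)\<close> onto the third axis. The sign of
  \<open>R\<close> is left open by \<open>polar_Ex\<close>, so the evenness of \<open>Omega3\<close>
  is used at the end.\<close>

lemma sphere_cos_eq: "sphere_cos a b c = 4 * pi * Omega3 (sqrt (a\<^sup>2 + b\<^sup>2 + c\<^sup>2))"
proof -
  obtain \<rho> s where 1: "a = \<rho> * cos s" "b = \<rho> * sin s"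
    using polar_Ex by blast
  obtain R u where 2: "\<rho> = R * cos u" "c = R * sin u"
    using polar_Ex by blast
  have "sphere_cos a b c = sphere_cos \<rho> 0 c"
    using sphere_cos_rotate12[of \<rho> s 0 c] by (simp add: 1)
  \<comment> \<open>The angle \<open>u\<close> is measured from the first axis while the target is
    the third, hence the shift by \<open>pi / 2\<close>.\<close>
  also have "\<dots> = sphere_cos 0 0 R"
    using sphere_cos_rotate13[of 0 "u - pi / 2" R 0] by (simp add: 2 sin_diff cos_diff)
  finally have "sphere_cos a b c = 4 * pi * Omega3 R"
    by (simp add: sphere_cos_axis)
  moreover have "a\<^sup>2 + b\<^sup>2 + c\<^sup>2 = R\<^sup>2"
  proof -
    have "a\<^sup>2 + b\<^sup>2 = \<rho>\<^sup>2 * ((cos s)\<^sup>2 + (sin s)\<^sup>2)"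
      unfolding 1 by (simp only: power_mult_distrib distrib_left)
    moreover have "\<rho>\<^sup>2 + c\<^sup>2 = R\<^sup>2 * ((cos u)\<^sup>2 + (sin u)\<^sup>2)"
      unfolding 2 by (simp only: power_mult_distrib distrib_left)
    ultimately show ?thesis
      by simp
  qed
  ultimately show ?thesis
    by (simp add: Omega3_abs)
qed

text \<open>The form is the squared modulus of the exponential sum with coefficients
  \<open>a i\<close> and phases \<open>u i\<close>.\<close>

lemma sum_sum_cos_diff_nonneg:
  fixes a u :: "'i \<Rightarrow> real"
  shows "0 \<le> (\<Sum>i\<in>I. \<Sum>j\<in>I. a i * a j * cos (u i - u j))"
proof -
  have "(\<Sum>i\<in>I. \<Sum>j\<in>I. a i * a j * cos (u i - u j)) =
      (\<Sum>i\<in>I. a i * cos (u i))\<^sup>2 + (\<Sum>i\<in>I. a i * sin (u i))\<^sup>2"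
    by (simp add: power2_eq_square sum_product sum.distrib cos_diff algebra_simps)
  then show ?thesis by simp
qed

text \<open>Each direction of the sphere contributes a nonnegative cosine form, and the surface
  density is nonnegative on the box.\<close>

lemma Omega3_norm_psd:
  fixes x :: "'i \<Rightarrow> real ^ 3" and a :: "'i \<Rightarrow> real"
  shows "0 \<le> (\<Sum>i\<in>I. \<Sum>j\<in>I. a i * a j * Omega3 (norm (x i - x j)))"
proof (cases "finite I")
  case fin: True
  define p where "p z = sphere_dir (z $ 1) (z $ 2) (z $ 3)" for z :: "real ^ 3"
  have p_diff: "p (z - w) t = p z t - p w t" for z w t
    by (simp add: p_def sphere_dir_def algebra_simps)
  have int: "(\<lambda>t. c * (cos (p z t) * sin (fst t))) integrable_on sphere_box" for z c
    unfolding p_def sphere_dir_def sphere_box_def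
    by (intro integrable_continuous continuous_intros)
  have *: "4 * pi * Omega3 (norm z) = integral sphere_box (\<lambda>t. cos (p z t) * sin (fst t))" for z
    using sphere_cos_eq[of "z $ 1" "z $ 2" "z $ 3"]
    by (simp add: p_def sphere_cos_def norm_vec_def L2_set_def sum_3)
  have "4 * pi * (\<Sum>i\<in>I. \<Sum>j\<in>I. a i * a j * Omega3 (norm (x i - x j))) =
      (\<Sum>i\<in>I. \<Sum>j\<in>I. a i * a j * (4 * pi * Omega3 (norm (x i - x j))))"
    by (simp add: sum_distrib_left mult_ac)
  also have "\<dots> = (\<Sum>i\<in>I. \<Sum>j\<in>I.
      integral sphere_box (\<lambda>t. a i * a j * (cos (p (x i - x j) t) * sin (fst t))))"
    by (simp add: *)
  also have "\<dots> = integral sphere_box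
      (\<lambda>t. \<Sum>i\<in>I. \<Sum>j\<in>I. a i * a j * (cos (p (x i - x j) t) * sin (fst t)))"
    using fin int by (simp add: integral_sum integrable_sum)
  also have "\<dots> \<ge> 0"
  proof (rule integral_nonneg)
    show "(\<lambda>t. \<Sum>i\<in>I. \<Sum>j\<in>I. a i * a j * (cos (p (x i - x j) t) * sin (fst t)))
        integrable_on sphere_box"
      using fin int by (intro integrable_sum) auto
    fix t assume "t \<in> sphere_box"
    then have "sin (fst t) \<ge> 0"
      by (cases t) (auto simp: sphere_box_def intro!: sin_ge_zero)
    moreover have "(\<Sum>i\<in>I. \<Sum>j\<in>I. a i * a j * (cos (p (x i - x j) t) * sin (fst t))) =
        sin (fst t) * (\<Sum>i\<in>I. \<Sum>j\<in>I. a i * a j * cos (p (x i) t - p (x j) t))"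
      by (simp add: p_diff sum_distrib_left mult_ac)
    ultimately show "0 \<le> (\<Sum>i\<in>I. \<Sum>j\<in>I. a i * a j * (cos (p (x i - x j) t) * sin (fst t)))"
      by (simp add: sum_sum_cos_diff_nonneg)
  qed
  finally show ?thesis
    using pi_gt_zero by (simp add: zero_le_mult_iff not_le)
qed simp

section \<open>The lattice of integer translates\<close>

text \<open>The reproducing kernel of the functions band-limited to \<open>[-pi, pi]\<close>; only
  its finite Gram forms appear below.\<close>

definition sincpi :: "real \<Rightarrow> real" where
  "sincpi x = Omega3 (pi * x)"

lemma sincpi_0 [simp]: "sincpi 0 = 1"
  by (simp add: sincpi_def Omega3_def)

lemma sincpi_minus [simp]: "sincpi (- x) = sincpi x"
  by (simp add: sincpi_def Omega3_def)

lemma sincpi_commute: "sincpi (x - y) = sincpi (y - x)"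
  using sincpi_minus[of "y - x"] by simp

lemma sincpi_of_int: "sincpi (of_int n) = (if n = 0 then 1 else 0)"
  by (simp add: sincpi_def Omega3_def sin_integer_2pi sin_zero_iff_int2 mult.commute)

text \<open>All integer translates share the factor \<open>sin (pi * x)\<close>. Divided by it, a
  combination of them becomes a sum of simple fractions, which is how interpolating functions are
  built later.\<close>

lemma sincpi_diff_int:
  assumes "x \<noteq> of_int n"
  shows "sincpi (x - of_int n) = (- 1) powi n * sin (pi * x) / (pi * (x - of_int n))"
proof -
  have "sin (pi * x - pi * of_int n) = sin (pi * x) * cos (pi * of_int n)"
    by (simp add: sin_diff mult.commute sin_zero_iff_int2)
  moreover have "cos (pi * of_int n) = (- 1) powi n"
    by (cases "even n") (auto simp: cos_npi_int power_int_minus_left mult.commute)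
  ultimately show ?thesis
    using assms by (simp add: sincpi_def Omega3_def right_diff_distrib mult.commute)
qed

lemma norm_axis3: "norm (vector [0, 0, a] - vector [0, 0, b] :: real ^ 3) = \<bar>a - b\<bar>"
  by (simp add: norm_vec_def L2_set_def sum_3)

lemma sincpi_psd:
  fixes u a :: "'i \<Rightarrow> real"
  shows "0 \<le> (\<Sum>i\<in>I. \<Sum>j\<in>I. a i * a j * sincpi (u i - u j))"
  using Omega3_norm_psd[where x = "\<lambda>i. vector [0, 0, pi * u i]" and a = a and I = I]
  by (simp add: norm_axis3 sincpi_def Omega3_abs right_diff_distrib)

text \<open>The squared norm of a combination of translates by the \<open>u i\<close> and by
  integers, the latter being orthonormal. Taking minus the projection coefficients for
  \<open>b\<close> gives Bessel's inequality; other choices give duality estimates.\<close>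

lemma sincpi_psd_int:
  fixes u a :: "'i \<Rightarrow> real" and T :: "int set"
  assumes fin: "finite I" "finite T"
  shows "0 \<le> (\<Sum>i\<in>I. \<Sum>j\<in>I. a i * a j * sincpi (u i - u j))
    + 2 * (\<Sum>i\<in>I. \<Sum>n\<in>T. a i * b n * sincpi (u i - of_int n)) + (\<Sum>n\<in>T. (b n)\<^sup>2)"
proof -
  define v where "v = case_sum u (of_int :: int \<Rightarrow> real)"
  define c where "c = case_sum a b"
  have "(\<Sum>n\<in>T. \<Sum>k\<in>T. b n * b k * sincpi (of_int n - of_int k)) =
      (\<Sum>n\<in>T. \<Sum>k\<in>T. if k = n then (b n)\<^sup>2 else 0)"
    using sincpi_of_int[of "n - k" for n k]
    by (intro sum.cong) (auto simp: power2_eq_square)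
  also have "\<dots> = (\<Sum>n\<in>T. (b n)\<^sup>2)"
    using fin by simp
  finally have 1: "(\<Sum>n\<in>T. \<Sum>k\<in>T. b n * b k * sincpi (of_int n - of_int k)) = (\<Sum>n\<in>T. (b n)\<^sup>2)" .
  have 2: "(\<Sum>n\<in>T. \<Sum>i\<in>I. b n * a i * sincpi (of_int n - u i)) =
      (\<Sum>i\<in>I. \<Sum>n\<in>T. a i * b n * sincpi (u i - of_int n))"
    by (subst sum.swap) (simp add: mult.commute sincpi_commute)
  show ?thesis
    using sincpi_psd[of c v "I <+> T"] fin 1 2
    by (simp add: sum.Plus v_def c_def sum.distrib)
qed

section \<open>The share of a translate captured by nearby integers\<close>

text \<open>The second logarithmic derivative of the reflection formula for \<open>Gamma\<close>.
  With the series of the trigamma function it evaluates the sum of inverse squared distances from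
  \<open>x\<close> to all integers.\<close>

lemma Polygamma1_reflection:
  fixes x :: real
  assumes "0 < x" "x < 1"
  shows "Polygamma 1 x + Polygamma 1 (1 - x) = pi\<^sup>2 / (sin (pi * x))\<^sup>2"
proof -
  have sin_pos: "sin (pi * t) > 0" if "0 < t" "t < 1" for t
    using that by (intro sin_gt_zero) auto
  have refl: "ln_Gamma t + ln_Gamma (1 - t) = ln pi - ln (sin (pi * t))" if t: "0 < t" "t < 1" for t
  proof -
    have "complex_of_real (Gamma t * Gamma (1 - t)) =
        Gamma (complex_of_real t) * Gamma (1 - complex_of_real t)"
      using Gamma_complex_of_real[of t] Gamma_complex_of_real[of "1 - t"] by simp
    also have "\<dots> = of_real pi / sin (of_real pi * of_real t)"
      by (rule Gamma_reflection_complex)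
    also have "\<dots> = complex_of_real (pi / sin (pi * t))"
      by (simp add: sin_of_real flip: of_real_mult)
    finally have "complex_of_real (Gamma t * Gamma (1 - t)) = complex_of_real (pi / sin (pi * t))" .
    then have "Gamma t * Gamma (1 - t) = pi / sin (pi * t)"
      using of_real_eq_iff by blast
    then have "ln (Gamma t * Gamma (1 - t)) = ln (pi / sin (pi * t))"
      by simp
    then show ?thesis
      using t sin_pos[OF t]
      by (simp add: ln_mult_pos ln_div ln_Gamma_real_pos)
  qed
  have digamma: "Digamma t - Digamma (1 - t) = - (pi * cos (pi * t) / sin (pi * t))"
    if t: "0 < t" "t < 1" for t
  proof (rule DERIV_unique)
    have "((\<lambda>t. ln pi - ln (sin (pi * t))) has_real_derivative
        - (pi * cos (pi * t) / sin (pi * t))) (at t)"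
      using sin_pos[OF t] by (auto intro!: derivative_eq_intros)
    then show "((\<lambda>t. ln_Gamma t + ln_Gamma (1 - t)) has_real_derivative
        - (pi * cos (pi * t) / sin (pi * t))) (at t)"
      by (rule has_field_derivative_transform_within_open[where S = "{0<..<1}"])
        (use t refl in auto)
    show "((\<lambda>t. ln_Gamma t + ln_Gamma (1 - t)) has_real_derivative Digamma t - Digamma (1 - t)) (at t)"
      using t by (auto intro!: derivative_eq_intros)
  qed
  have nz: "sin (pi * x) \<noteq> 0"
    using sin_pos[OF assms] by simp
  have "Polygamma 1 x + Polygamma 1 (1 - x) =
      pi\<^sup>2 * ((sin (pi * x))\<^sup>2 + (cos (pi * x))\<^sup>2) / (sin (pi * x))\<^sup>2"
  proof (rule DERIV_unique)
    have "((\<lambda>t. - (pi * cos (pi * t) / sin (pi * t))) has_real_derivative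
       pi\<^sup>2 * ((sin (pi * x))\<^sup>2 + (cos (pi * x))\<^sup>2) / (sin (pi * x))\<^sup>2) (at x)"
      using nz by (auto intro!: derivative_eq_intros simp: field_simps power2_eq_square
          simp del: sin_cos_squared_add sin_cos_squared_add2 sin_cos_squared_add3)
    then show "((\<lambda>t. Digamma t - Digamma (1 - t)) has_real_derivative
       pi\<^sup>2 * ((sin (pi * x))\<^sup>2 + (cos (pi * x))\<^sup>2) / (sin (pi * x))\<^sup>2) (at x)"
      by (rule has_field_derivative_transform_within_open[where S = "{0<..<1}"])
        (use assms digamma in auto)
    have "x \<notin> \<int>\<^sub>\<le>\<^sub>0" "1 - x \<notin> \<int>\<^sub>\<le>\<^sub>0"
      using assms by (auto elim!: nonpos_Ints_cases)
    then show "((\<lambda>t. Digamma t - Digamma (1 - t)) has_real_derivative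
       Polygamma 1 x + Polygamma 1 (1 - x)) (at x)"
      by (auto intro!: derivative_eq_intros)
  qed
  then show ?thesis by simp
qed

text \<open>The tail of the trigamma series is dominated by the telescoping differences
  \<open>1 / (M - 1) - 1 / M\<close>.\<close>

lemma Polygamma1_le_partial_sum:
  fixes x :: real
  assumes "x > 0" "N \<ge> 2"
  shows "Polygamma 1 x \<le> (\<Sum>k<N. 1 / (x + real k)\<^sup>2) + 1 / (real N - 1)"
proof -
  define f where "f k = 1 / (x + real k)\<^sup>2" for k
  have sums: "f sums Polygamma 1 x"
    using Polygamma_LIMSEQ[of x 1] assms by (simp add: f_def [abs_def] inverse_eq_divide eval_nat_numeral)
  have f_nonneg: "f k \<ge> 0" for k
    by (simp add: f_def)
  have ge: "sum f {..<M} \<le> sum f {..<N} + (1 / (real N - 1) - 1 / (real M - 1))" if "M \<ge> N" for M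
    using that
  proof (induction M rule: dec_induct)
    case (step M)
    have M: "real M \<ge> 2"
      using step assms by linarith
    have "f M \<le> 1 / (real M)\<^sup>2"
      unfolding f_def using M assms by (intro divide_left_mono power_mono mult_pos_pos) auto
    also have "\<dots> \<le> 1 / (real M - 1) - 1 / real M"
      using M by (simp add: field_simps power2_eq_square)
    finally show ?case
      using step.IH by simp
  qed simp
  have "sum f {..<M} \<le> sum f {..<N} + 1 / (real N - 1)" for M
  proof (cases "M \<ge> N")
    case True
    have "1 / (real M - 1) \<ge> 0"
      using True assms by simp
    with ge[OF True] show ?thesis by linarith
  next
    case False
    then have "sum f {..<M} \<le> sum f {..<N}"
      using f_nonneg by (intro sum_mono2) auto
    moreover have "1 / (real N - 1) \<ge> 0"
      using assms by simp
    ultimately show ?thesis by linarith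
  qed
  then have "suminf f \<le> sum f {..<N} + 1 / (real N - 1)"
    using sums by (intro suminf_le_const) (auto simp: sums_iff)
  then show ?thesis
    using sums by (simp add: sums_iff f_def)
qed

text \<open>Over all integers the squares sum to one (Parseval); the tails on the two sides cost at
  most \<open>1 / (real N - 1)\<close> each.\<close>

lemma sincpi_sum_squares_ge:
  assumes "N \<ge> 2" and W: "finite W" "\<And>n. \<bar>of_int n - x\<bar> \<le> real N \<Longrightarrow> n \<in> W"
  shows "(\<Sum>n\<in>W. (sincpi (x - of_int n))\<^sup>2) \<ge> 1 - 2 / (real N - 1)"
proof -
  define m where "m = \<lfloor>x\<rfloor>"
  define y where "y = x - of_int m"
  have y: "0 \<le> y" "y < 1"
    unfolding y_def m_def by linarith+
  show ?thesis
  proof (cases "y = 0")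
    case True
    then have "x = of_int m"
      by (simp add: y_def)
    then have "1 = (\<Sum>n\<in>{m}. (sincpi (x - of_int n))\<^sup>2)"
      by simp
    also have "\<dots> \<le> (\<Sum>n\<in>W. (sincpi (x - of_int n))\<^sup>2)"
      using W \<open>x = of_int m\<close> by (intro sum_mono2) auto
    finally have "1 \<le> (\<Sum>n\<in>W. (sincpi (x - of_int n))\<^sup>2)" .
    moreover have "2 / (real N - 1) \<ge> 0"
      using assms by simp
    ultimately show ?thesis by linarith
  next
    case False
    with y have y: "0 < y" "y < 1" by auto
    \<comment> \<open>The squared sine has period one in \<open>y\<close>, so every square is the
      same \<open>c\<close> over a squared distance.\<close>
    define c where "c = (sin (pi * y))\<^sup>2 / pi\<^sup>2"
    have sin_y: "sin (pi * y) > 0"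
      using y by (intro sin_gt_zero) auto
    have c: "0 < c" "c \<le> 1"
    proof -
      have "(sin (pi * y))\<^sup>2 \<le> 1"
        by (simp add: abs_square_le_1)
      also have "1 \<le> pi\<^sup>2"
        using pi_gt3 by (simp add: one_le_power)
      finally show "0 < c" "c \<le> 1"
        using sin_y by (simp_all add: c_def)
    qed
    have sinc: "(sincpi z)\<^sup>2 = c * (1 / z\<^sup>2)" if "z = y + of_int n" for z n
    proof -
      have "z \<noteq> 0"
        using that y by (smt (verit) of_int_less_iff of_int_0 of_int_minus of_int_1 of_int_le_iff)
      have "sin (pi * z) = sin (pi * y) * cos (pi * of_int n)"
        unfolding that by (simp add: distrib_left sin_add sin_zero_iff_int2 mult.commute)
      moreover have "(cos (pi * of_int n))\<^sup>2 = 1"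
        by (simp add: mult.commute cos_npi_int)
      ultimately show ?thesis
        using \<open>z \<noteq> 0\<close> by (simp add: sincpi_def Omega3_def c_def power_mult_distrib power_divide)
    qed
    \<comment> \<open>\<open>A\<close> and \<open>B\<close> are the \<open>N\<close> integers next
      to \<open>x\<close> on either side, all within distance \<open>N\<close>.\<close>
    define A where "A = (\<lambda>k. m - int k) ` {..<N}"
    define B where "B = (\<lambda>k. m + 1 + int k) ` {..<N}"
    have "(\<Sum>n\<in>A. (sincpi (x - of_int n))\<^sup>2) = (\<Sum>k<N. (sincpi (x - of_int (m - int k)))\<^sup>2)"
      unfolding A_def by (subst sum.reindex) (auto simp: inj_on_def)
    also have "\<dots> = (\<Sum>k<N. c * (1 / (y + real k)\<^sup>2))"
    proof (rule sum.cong)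
      fix k
      have eq: "x - of_int (m - int k) = y + of_int (int k)"
        by (simp add: y_def)
      from sinc[OF this] show "(sincpi (x - of_int (m - int k)))\<^sup>2 = c * (1 / (y + real k)\<^sup>2)"
        unfolding eq by simp
    qed simp
    finally have A: "(\<Sum>n\<in>A. (sincpi (x - of_int n))\<^sup>2) = c * (\<Sum>k<N. 1 / (y + real k)\<^sup>2)"
      by (simp add: sum_distrib_left)
    have "(\<Sum>n\<in>B. (sincpi (x - of_int n))\<^sup>2) = (\<Sum>k<N. (sincpi (x - of_int (m + 1 + int k)))\<^sup>2)"
      unfolding B_def by (subst sum.reindex) (auto simp: inj_on_def)
    also have "\<dots> = (\<Sum>k<N. c * (1 / (1 - y + real k)\<^sup>2))"
    proof (rule sum.cong)
      fix k
      have "x - of_int (m + 1 + int k) = y + of_int (- 1 - int k)"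
        by (simp add: y_def)
      then have "(sincpi (x - of_int (m + 1 + int k)))\<^sup>2 = c * (1 / (x - of_int (m + 1 + int k))\<^sup>2)"
        by (rule sinc)
      also have "(x - of_int (m + 1 + int k))\<^sup>2 = (1 - y + real k)\<^sup>2"
        by (simp add: y_def power2_commute[of x] algebra_simps power2_eq_square)
      finally show "(sincpi (x - of_int (m + 1 + int k)))\<^sup>2 = c * (1 / (1 - y + real k)\<^sup>2)" .
    qed simp
    finally have B: "(\<Sum>n\<in>B. (sincpi (x - of_int n))\<^sup>2) = c * (\<Sum>k<N. 1 / (1 - y + real k)\<^sup>2)"
      by (simp add: sum_distrib_left)
    have "c * (Polygamma 1 y + Polygamma 1 (1 - y)) = 1"
      using Polygamma1_reflection[OF y] sin_y by (simp add: c_def)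
    moreover have "c * (Polygamma 1 y + Polygamma 1 (1 - y)) \<le>
        c * ((\<Sum>k<N. 1 / (y + real k)\<^sup>2) + (\<Sum>k<N. 1 / (1 - y + real k)\<^sup>2) + 2 / (real N - 1))"
      using Polygamma1_le_partial_sum[of y N] Polygamma1_le_partial_sum[of "1 - y" N] y assms c
      by (intro mult_left_mono) auto
    moreover have "c * (2 / (real N - 1)) \<le> 1 * (2 / (real N - 1))"
      using c assms by (intro mult_right_mono) auto
    ultimately have "1 - 2 / (real N - 1) \<le>
        c * (\<Sum>k<N. 1 / (y + real k)\<^sup>2) + c * (\<Sum>k<N. 1 / (1 - y + real k)\<^sup>2)"
      by (simp add: distrib_left)
    also have "\<dots> = (\<Sum>n\<in>A \<union> B. (sincpi (x - of_int n))\<^sup>2)"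
      unfolding A [symmetric] B [symmetric]
      by (rule sum.union_disjoint [symmetric]) (auto simp: A_def B_def)
    also have "\<dots> \<le> (\<Sum>n\<in>W. (sincpi (x - of_int n))\<^sup>2)"
    proof (rule sum_mono2)
      show "A \<union> B \<subseteq> W"
        using y by (auto simp: A_def B_def y_def intro!: W(2))
    qed (use W in auto)
    finally show ?thesis .
  qed
qed

section \<open>Interpolation at the points of a sparse sequence\<close>

text \<open>After clearing denominators both sides are polynomials of degree below
  \<open>card S\<close> that agree at the points of \<open>S\<close>.\<close>

lemma lagrange_partial_fractions:
  fixes z :: "'i \<Rightarrow> real" and S :: "int set"
  assumes S: "finite S" and card: "card J < card S" and x: "x \<notin> of_int ` S"
  shows "(\<Prod>j\<in>J. x - z j) / (\<Prod>s\<in>S. x - of_int s) =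
    (\<Sum>n\<in>S. (\<Prod>j\<in>J. of_int n - z j) / (\<Prod>s\<in>S - {n}. of_int n - of_int s) / (x - of_int n))"
proof -
  define c where "c n = (\<Prod>j\<in>J. of_int n - z j) / (\<Prod>s\<in>S - {n}. of_int n - of_int s)" for n :: int
  define p where "p = (\<Prod>j\<in>J. [:- z j, 1:])"
  define q where "q = (\<Sum>n\<in>S. smult (c n) (\<Prod>s\<in>S - {n}. [:- of_int s, 1:]))"
  have card_S: "card (of_int ` S :: real set) = card S"
    by (simp add: card_image inj_on_def)
  have "S \<noteq> {}"
    using card by auto
  have "p = q"
  proof (rule poly_eqI_degree[where A = "of_int ` S"])
    show "degree p < card (of_int ` S :: real set)"
      unfolding card_S p_def using degree_prod_sum_le[of J "\<lambda>j. [:- z j, 1:]"] card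
      by (cases "finite J") (auto simp: card_gt_0_iff S \<open>S \<noteq> {}\<close>)
    have "degree q \<le> card S - 1"
      unfolding q_def
    proof (intro degree_sum_le)
      fix n assume "n \<in> S"
      then show "degree (smult (c n) (\<Prod>s\<in>S - {n}. [:- of_int s, 1:])) \<le> card S - 1"
        using degree_prod_sum_le[of "S - {n}" "\<lambda>s. [:- of_int s, 1:] :: real poly"] S
        by (intro order_trans[OF degree_smult_le]) simp
    qed (use S in auto)
    then show "degree q < card (of_int ` S :: real set)"
      unfolding card_S using card by linarith
    fix y :: real assume "y \<in> of_int ` S"
    then obtain k where k: "k \<in> S" "y = of_int k" by auto
    have "poly q y = (\<Sum>n\<in>S. c n * (\<Prod>s\<in>S - {n}. y - of_int s))"
      by (simp add: q_def poly_sum poly_prod)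
    also have "\<dots> = (\<Sum>n\<in>S. if n = k then c k * (\<Prod>s\<in>S - {k}. y - of_int s) else 0)"
      using S k by (intro sum.cong) auto
    also have "\<dots> = c k * (\<Prod>s\<in>S - {k}. y - of_int s)"
      using S k by simp
    also have "\<dots> = poly p y"
      using S by (simp add: c_def p_def k poly_prod)
    finally show "poly p y = poly q y" ..
  qed
  moreover have "poly p x = (\<Prod>j\<in>J. x - z j)"
    by (simp add: p_def poly_prod)
  moreover have "poly q x = (\<Sum>n\<in>S. c n * (\<Prod>s\<in>S - {n}. x - of_int s))"
    by (simp add: q_def poly_sum poly_prod)
  ultimately have "(\<Prod>j\<in>J. x - z j) / (\<Prod>s\<in>S. x - of_int s) =
      (\<Sum>n\<in>S. c n * (\<Prod>s\<in>S - {n}. x - of_int s) / (\<Prod>s\<in>S. x - of_int s))"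
    unfolding sum_divide_distrib [symmetric] by simp
  also have "\<dots> = (\<Sum>n\<in>S. c n / (x - of_int n))"
  proof (rule sum.cong)
    fix n assume n: "n \<in> S"
    have "(\<Prod>s\<in>S - {n}. x - of_int s) \<noteq> 0" "x - of_int n \<noteq> 0"
      using S x n by auto
    with n S show "c n * (\<Prod>s\<in>S - {n}. x - of_int s) / (\<Prod>s\<in>S. x - of_int s) = c n / (x - of_int n)"
      by (simp add: prod.remove)
  qed simp
  finally show ?thesis
    by (simp add: c_def)
qed

text \<open>
  The avoided residue class modulo \<open>L\<close> is the supply of integers that can be deleted as zeros near
  any given point.
\<close>

lemma block_matching:
  fixes \<mu> :: "nat \<Rightarrow> real" and L :: nat
  assumes "L \<ge> 1" and count: "\<And>a. card {k\<in>{..<m}. \<mu> k \<in> {a..a + real L}} < L"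
  obtains \<sigma> :: "nat \<Rightarrow> int"
  where "inj_on \<sigma> {..<m}" "\<And>k. k < m \<Longrightarrow> \<bar>of_int (\<sigma> k) - \<mu> k\<bar> \<le> real L"
    "\<And>k. k < m \<Longrightarrow> \<sigma> k mod int L \<noteq> int L - 1"
proof -
  define blk where "blk k = \<lfloor>\<mu> k / real L\<rfloor>" for k
  define A where "A j = {k\<in>{..<m}. blk k = j}" for j
  \<comment> \<open>A block of length \<open>L\<close> holds at most \<open>L - 1\<close> points, so
    the offsets \<open>0\<close> to \<open>L - 2\<close> suffice and the last offset stays free in
    every block.\<close>
  have "\<exists>e. e ` A j \<subseteq> {0..<int L - 1} \<and> inj_on e (A j)" for j
  proof -
    have "A j \<subseteq> {k\<in>{..<m}. \<mu> k \<in> {of_int j * real L..of_int j * real L + real L}}"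
    proof
      fix k assume "k \<in> A j"
      then have "k < m" "of_int j \<le> \<mu> k / real L" "\<mu> k / real L \<le> of_int j + 1"
        by (auto simp: A_def blk_def)
      then show "k \<in> {k\<in>{..<m}. \<mu> k \<in> {of_int j * real L..of_int j * real L + real L}}"
        using assms(1) by (auto simp: field_simps)
    qed
    then have "card (A j) \<le> card {k\<in>{..<m}. \<mu> k \<in> {of_int j * real L..of_int j * real L + real L}}"
      by (intro card_mono) auto
    then have "card (A j) \<le> card {0..<int L - 1}"
      using count[of "of_int j * real L"] by simp
    then show ?thesis
      by (metis card_le_inj finite_atLeastLessThan_int finite_subset finite_lessThan A_def mem_Collect_eq subsetI)
  qed
  then obtain e where e: "\<And>j. e j ` A j \<subseteq> {0..<int L - 1}" "\<And>j. inj_on (e j) (A j)"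
    by metis
  define \<sigma> where "\<sigma> k = int L * blk k + e (blk k) k" for k
  have e_bounds: "0 \<le> e (blk k) k" "e (blk k) k < int L - 1" if "k < m" for k
    using e(1)[of "blk k"] that by (auto simp: A_def)
  have div: "\<sigma> k div int L = blk k" and md: "\<sigma> k mod int L = e (blk k) k" if "k < m" for k
    using e_bounds[OF that] by (auto simp: \<sigma>_def)
  show ?thesis
  proof
    show "inj_on \<sigma> {..<m}"
    proof (rule inj_onI)
      fix k l assume kl: "k \<in> {..<m}" "l \<in> {..<m}" "\<sigma> k = \<sigma> l"
      then have "blk k = blk l" "e (blk k) k = e (blk l) l"
        using div md by (metis lessThan_iff)+
      then show "k = l"
        using kl e(2)[of "blk l"] by (auto simp: A_def inj_on_def)
    qed
    fix k assume k: "k < m"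
    show "\<sigma> k mod int L \<noteq> int L - 1"
      using md[OF k] e_bounds[OF k] by simp
    have "of_int (blk k) \<le> \<mu> k / real L" "\<mu> k / real L \<le> of_int (blk k) + 1"
      unfolding blk_def by linarith+
    then have "of_int (blk k) * real L \<le> \<mu> k" "\<mu> k \<le> of_int (blk k) * real L + real L"
      using assms(1) by (auto simp: field_simps)
    moreover have "of_int (\<sigma> k) = of_int (blk k) * real L + of_int (e (blk k) k)"
      by (simp add: \<sigma>_def)
    moreover have "0 \<le> real_of_int (e (blk k) k)" "real_of_int (e (blk k) k) \<le> real L"
      using e_bounds[OF k] by linarith+
    ultimately show "\<bar>of_int (\<sigma> k) - \<mu> k\<bar> \<le> real L"
      by linarith
  qed
qed

section \<open>Estimates of sums over the integers\<close>

text \<open>The absolute value is injective on the nonnegative and on the negative integers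
  separately.\<close>

lemma sum_nat_abs_le:
  fixes g :: "nat \<Rightarrow> real" and T :: "int set"
  assumes "finite T" "finite I" "\<And>l. l \<in> T \<Longrightarrow> nat \<bar>l\<bar> \<in> I" "\<And>i. i \<in> I \<Longrightarrow> g i \<ge> 0"
  shows "(\<Sum>l\<in>T. g (nat \<bar>l\<bar>)) \<le> 2 * (\<Sum>i\<in>I. g i)"
proof -
  have half: "(\<Sum>l\<in>U. g (nat \<bar>l\<bar>)) \<le> (\<Sum>i\<in>I. g i)"
    if "U \<subseteq> T" "inj_on (\<lambda>l. nat \<bar>l\<bar>) U" for U
  proof -
    have "(\<Sum>l\<in>U. g (nat \<bar>l\<bar>)) = (\<Sum>i\<in>(\<lambda>l. nat \<bar>l\<bar>) ` U. g i)"
      using that by (simp add: sum.reindex)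
    also have "\<dots> \<le> (\<Sum>i\<in>I. g i)"
      using assms that by (intro sum_mono2) auto
    finally show ?thesis .
  qed
  have "(\<Sum>l\<in>T. g (nat \<bar>l\<bar>)) = (\<Sum>l\<in>{l\<in>T. l \<ge> 0} \<union> {l\<in>T. l < 0}. g (nat \<bar>l\<bar>))"
    by (rule sum.cong) auto
  also have "\<dots> = (\<Sum>l\<in>{l\<in>T. l \<ge> 0}. g (nat \<bar>l\<bar>)) + (\<Sum>l\<in>{l\<in>T. l < 0}. g (nat \<bar>l\<bar>))"
    using assms(1) by (intro sum.union_disjoint) auto
  also have "\<dots> \<le> 2 * (\<Sum>i\<in>I. g i)"
  proof -
    have "inj_on (\<lambda>l. nat \<bar>l\<bar>) {l\<in>T. l \<ge> 0}" "inj_on (\<lambda>l. nat \<bar>l\<bar>) {l\<in>T. l < 0}"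
      by (auto simp: inj_on_def)
    with half[of "{l\<in>T. l \<ge> 0}"] half[of "{l\<in>T. l < 0}"] show ?thesis
      by (simp only:) auto
  qed
  finally show ?thesis .
qed

lemma sum_inverse_squares_le:
  assumes "M \<ge> 1" "M \<le> K"
  shows "(\<Sum>i\<in>{M<..K}. 1 / (real i)\<^sup>2) \<le> 1 / real M - 1 / real K"
  using assms(2)
proof (induction K rule: dec_induct)
  case (step K)
  have "1 / (real (Suc K))\<^sup>2 \<le> 1 / real K - 1 / real (Suc K)"
  proof -
    have "real K > 0"
      using step assms(1) by simp
    then have "1 / (real (Suc K))\<^sup>2 \<le> 1 / (real K * real (Suc K))"
      unfolding power2_eq_square by (intro divide_left_mono mult_right_mono mult_pos_pos) auto
    also have "\<dots> = 1 / real K - 1 / real (Suc K)"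
      using \<open>real K > 0\<close> by (simp add: divide_simps)
    finally show ?thesis .
  qed
  moreover have "{M<..Suc K} = insert (Suc K) {M<..K}"
    using step by auto
  ultimately show ?case
    using step.IH by simp
qed simp

lemma sum_int_inverse_squares_tail:
  fixes T :: "int set"
  assumes "finite T" "M \<ge> 1" "\<And>l. l \<in> T \<Longrightarrow> \<bar>l\<bar> > int M"
  shows "(\<Sum>l\<in>T. 1 / (of_int \<bar>l\<bar>)\<^sup>2) \<le> 2 / real M"
proof -
  obtain K0 where K0: "\<And>l. l \<in> T \<Longrightarrow> nat \<bar>l\<bar> \<le> K0"
    using assms(1) by (meson finite_nat_set_iff_bounded_le finite_imageI imageI)
  define K where "K = max M K0"
  have "(\<Sum>l\<in>T. 1 / (of_int \<bar>l\<bar>)\<^sup>2) = (\<Sum>l\<in>T. 1 / (real (nat \<bar>l\<bar>))\<^sup>2)"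
    by simp
  also have "\<dots> \<le> 2 * (\<Sum>i\<in>{M<..K}. 1 / (real i)\<^sup>2)"
    using assms K0 by (intro sum_nat_abs_le) (fastforce simp: K_def max_def nat_le_iff)+
  also have "\<dots> \<le> 2 * (1 / real M - 1 / real K)"
    using assms by (intro mult_left_mono sum_inverse_squares_le) (auto simp: K_def)
  also have "\<dots> \<le> 2 / real M"
    by (simp add: right_diff_distrib)
  finally show ?thesis .
qed

text \<open>Each sign contributes at most a harmonic number; \<open>max 1\<close> gives the term
  \<open>l = 0\<close> the weight one.\<close>

lemma sum_int_inverse_le_ln:
  fixes T :: "int set"
  assumes "finite T" "\<And>l. l \<in> T \<Longrightarrow> \<bar>l\<bar> \<le> int K"
  shows "(\<Sum>l\<in>T. 1 / max 1 (of_int \<bar>l\<bar>)) \<le> 4 + 2 * ln (1 + real K)"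
proof -
  have "(\<Sum>l\<in>T. 1 / max 1 (of_int \<bar>l\<bar>)) = (\<Sum>l\<in>T. 1 / max 1 (real (nat \<bar>l\<bar>)))"
    by simp
  also have "\<dots> \<le> 2 * (\<Sum>i\<in>{..K}. 1 / max 1 (real i))"
    using assms by (intro sum_nat_abs_le) (auto simp: nat_le_iff)
  also have "(\<Sum>i\<in>{..K}. 1 / max 1 (real i)) = 1 + harm K"
  proof -
    have "{..K} = insert 0 {1..K}" by auto
    then show ?thesis
      by (simp add: harm_def inverse_eq_divide max_def)
  qed
  also have "harm K \<le> 1 + ln (1 + real K)"
  proof (cases "K = 0")
    case False
    have "harm K - ln (real K) \<le> harm 1 - ln (real 1)"
      using False by (intro euler_mascheroni_sequence_decreasing) auto
    moreover have "ln (real K) \<le> ln (1 + real K)"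
      using False by simp
    ultimately show ?thesis by (simp add: harm_def)
  qed (simp add: harm_def)
  finally show ?thesis by simp
qed

text \<open>Controls the total distortion caused by moving the zeros. The coefficient 8 of the
  logarithm becomes the exponent of the polynomial growth and so decides how many zeros must be
  deleted.\<close>

lemma sum_convolution_le_ln:
  fixes T :: "int set" and p :: int
  assumes fin: "finite T"
  shows "(\<Sum>l\<in>T. (of_int \<bar>p\<bar> + 1) / (max 1 (of_int \<bar>p - l\<bar>) * max 1 (of_int \<bar>l\<bar>)))
    \<le> 36 + 8 * ln (1 + real_of_int \<bar>p\<bar>)"
proof -
  define P where "P = nat \<bar>p\<bar>"
  have P: "int P = \<bar>p\<bar>" "real P = real_of_int \<bar>p\<bar>"
    by (auto simp: P_def)
  define t where "t l = (real P + 1) / (max 1 (real_of_int \<bar>p - l\<bar>) * max 1 (real_of_int \<bar>l\<bar>))" for l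
  \<comment> \<open>Both harmonic lengths below lead to an argument of at most
    \<open>4 * (1 + real P)\<close>, and \<open>4 \<le> exp 2\<close> turns the factor into a
    summand 2.\<close>
  have ln_le: "ln x \<le> 2 + ln (1 + real P)" if "0 < x" "x \<le> 4 * (1 + real P)" for x
  proof -
    have "(2 :: real) * 2 \<le> exp 1 * exp 1"
      using exp_ge_add_one_self[of 1] by (intro mult_mono) auto
    then have "4 \<le> exp (2 :: real)"
      by (simp flip: exp_add)
    then have "4 * (1 + real P) \<le> exp 2 * (1 + real P)"
      by (rule mult_right_mono) simp
    from order_trans[OF that(2) this] have "x \<le> exp 2 * (1 + real P)" .
    with that have "ln x \<le> ln (exp 2 * (1 + real P))"
      by (subst ln_le_cancel_iff) auto
    then show ?thesis
      by (simp add: ln_mult)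
  qed
  \<comment> \<open>On \<open>T1\<close> the triangle inequality splits the product of reciprocals
    into a sum of two; on \<open>T2\<close> one has
    \<open>\<bar>p - l\<bar> \<ge> \<bar>l\<bar> / 2\<close>, so inverse squares suffice.\<close>
  define T1 where "T1 = {l\<in>T. \<bar>l\<bar> \<le> int (2 * P + 1)}"
  define T2 where "T2 = {l\<in>T. \<bar>l\<bar> > int (2 * P + 1)}"
  have "sum t T1 \<le> (\<Sum>l\<in>T1. 2 * (1 / max 1 (real_of_int \<bar>l\<bar>) + 1 / max 1 (real_of_int \<bar>p - l\<bar>)))"
  proof (rule sum_mono)
    fix l
    define a where "a = max 1 (real_of_int \<bar>p - l\<bar>)"
    define b where "b = max 1 (real_of_int \<bar>l\<bar>)"
    have ab: "a \<ge> 1" "b \<ge> 1"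
      by (auto simp: a_def b_def)
    have "\<bar>p\<bar> \<le> \<bar>p - l\<bar> + \<bar>l\<bar>" by linarith
    then have "real P \<le> real_of_int \<bar>p - l\<bar> + real_of_int \<bar>l\<bar>"
      unfolding P(2) by linarith
    moreover have "real_of_int \<bar>p - l\<bar> \<le> a" "real_of_int \<bar>l\<bar> \<le> b"
      unfolding a_def b_def by (rule max.cobounded2)+
    ultimately have "real P \<le> a + b"
      by (meson add_mono order_trans)
    moreover have "1 \<le> a + b"
      using ab by simp
    ultimately have "real P + 1 \<le> 2 * (a + b)"
      by simp
    then have "(real P + 1) / (a * b) \<le> 2 * (a + b) / (a * b)"
      using ab by (intro divide_right_mono) auto
    also have "\<dots> = 2 * (1 / b + 1 / a)"
      using ab by (simp add: divide_simps)
    finally show "t l \<le> 2 * (1 / max 1 (real_of_int \<bar>l\<bar>) + 1 / max 1 (real_of_int \<bar>p - l\<bar>))"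
      unfolding t_def a_def b_def .
  qed
  also have "\<dots> = 2 * ((\<Sum>l\<in>T1. 1 / max 1 (real_of_int \<bar>l\<bar>)) +
      (\<Sum>l\<in>T1. 1 / max 1 (real_of_int \<bar>p - l\<bar>)))"
    by (simp add: sum_distrib_left sum.distrib)
  also have "(\<Sum>l\<in>T1. 1 / max 1 (real_of_int \<bar>p - l\<bar>)) = (\<Sum>l\<in>(\<lambda>l. p - l) ` T1. 1 / max 1 (real_of_int \<bar>l\<bar>))"
    by (subst sum.reindex) (auto simp: inj_on_def)
  also have "\<dots> \<le> 4 + 2 * ln (1 + real (3 * P + 1))"
    using fin P(1) by (intro sum_int_inverse_le_ln) (auto simp: T1_def)
  also have "(\<Sum>l\<in>T1. 1 / max 1 (real_of_int \<bar>l\<bar>)) \<le> 4 + 2 * ln (1 + real (2 * P + 1))"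
    using fin by (intro sum_int_inverse_le_ln) (auto simp: T1_def)
  also have "ln (1 + real (2 * P + 1)) \<le> 2 + ln (1 + real P)"
    by (rule ln_le) simp_all
  also have "ln (1 + real (3 * P + 1)) \<le> 2 + ln (1 + real P)"
    by (rule ln_le) simp_all
  finally have 1: "sum t T1 \<le> 32 + 8 * ln (1 + real P)"
    by simp
  have "sum t T2 \<le> (\<Sum>l\<in>T2. 2 * (real P + 1) * (1 / (of_int \<bar>l\<bar>)\<^sup>2))"
  proof (rule sum_mono)
    fix l assume "l \<in> T2"
    then have l: "\<bar>l\<bar> > 2 * \<bar>p\<bar> + 1"
      by (auto simp: T2_def P)
    have far: "X \<ge> 1 \<and> X \<ge> Y / 2 \<and> Y \<ge> 1" if "Y > 2 * Z + 1" "Y \<le> X + Z" "Z \<ge> 0" for X Y Z :: real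
      using that by auto
    have "real_of_int \<bar>l\<bar> > 2 * real_of_int \<bar>p\<bar> + 1"
      using l by linarith
    moreover have "real_of_int \<bar>l\<bar> \<le> real_of_int \<bar>p - l\<bar> + real_of_int \<bar>p\<bar>"
      by linarith
    moreover have "0 \<le> real_of_int \<bar>p\<bar>"
      by simp
    ultimately have l: "real_of_int \<bar>p - l\<bar> \<ge> 1" "real_of_int \<bar>p - l\<bar> \<ge> real_of_int \<bar>l\<bar> / 2"
        "real_of_int \<bar>l\<bar> \<ge> 1"
      using far[of "real_of_int \<bar>p\<bar>" "real_of_int \<bar>l\<bar>" "real_of_int \<bar>p - l\<bar>"] by blast+
    then have "t l = (real P + 1) / (real_of_int \<bar>p - l\<bar> * real_of_int \<bar>l\<bar>)"
      by (simp add: t_def max_def)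
    also have "\<dots> \<le> (real P + 1) / (real_of_int \<bar>l\<bar> / 2 * real_of_int \<bar>l\<bar>)"
      using l by (intro divide_left_mono mult_right_mono mult_pos_pos) auto
    finally show "t l \<le> 2 * (real P + 1) * (1 / (of_int \<bar>l\<bar>)\<^sup>2)"
      by (simp add: power2_eq_square mult_ac)
  qed
  also have "\<dots> = 2 * (real P + 1) * (\<Sum>l\<in>T2. 1 / (of_int \<bar>l\<bar>)\<^sup>2)"
    by (simp add: sum_distrib_left)
  also have "\<dots> \<le> 2 * (real P + 1) * (2 / real (2 * P + 1))"
    using fin by (intro mult_left_mono sum_int_inverse_squares_tail) (auto simp: T2_def)
  also have "\<dots> \<le> 4"
    by (simp add: field_simps)
  finally have 2: "sum t T2 \<le> 4" .
  have "sum t T = sum t (T1 \<union> T2)"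
    by (rule sum.cong) (auto simp: T1_def T2_def)
  also have "\<dots> = sum t T1 + sum t T2"
    using fin by (intro sum.union_disjoint) (auto simp: T1_def T2_def)
  finally show ?thesis
    using 1 2 by (simp add: t_def [abs_def] P(2))
qed

text \<open>A bound uniform in \<open>q\<close> and \<open>T\<close>, used for both the row and the
  column sums in Schur's test.\<close>

lemma sum_int_inverse_square_Suc_le:
  fixes T :: "int set" and q :: int
  assumes "finite T"
  shows "(\<Sum>n\<in>T. 1 / (1 + of_int \<bar>n - q\<bar>)\<^sup>2) \<le> (4 :: real)"
proof -
  define U where "U = (\<lambda>n. n - q) ` T"
  obtain K where K: "\<And>l. l \<in> U \<Longrightarrow> nat \<bar>l\<bar> \<le> K"
    using assms by (metis U_def finite_nat_set_iff_bounded_le finite_imageI imageI)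
  have "(\<Sum>n\<in>T. 1 / (1 + real_of_int \<bar>n - q\<bar>)\<^sup>2) = (\<Sum>l\<in>U. 1 / (1 + real_of_int \<bar>l\<bar>)\<^sup>2)"
    unfolding U_def by (subst sum.reindex) (auto simp: inj_on_def)
  also have "\<dots> = (\<Sum>l\<in>U. 1 / (1 + real (nat \<bar>l\<bar>))\<^sup>2)"
    by simp
  also have "\<dots> \<le> 2 * (\<Sum>i\<in>{..K}. 1 / (1 + real i)\<^sup>2)"
    using assms K by (intro sum_nat_abs_le) (auto simp: U_def)
  also have "(\<Sum>i\<in>{..K}. 1 / (1 + real i)\<^sup>2) = 1 + (\<Sum>i\<in>{1<..Suc K}. 1 / (real i)\<^sup>2)"
  proof -
    have "(\<Sum>i\<in>{..K}. 1 / (1 + real i)\<^sup>2) = (\<Sum>i\<in>{..K}. 1 / (real (Suc i))\<^sup>2)"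
      by (simp add: add.commute)
    also have "\<dots> = (\<Sum>i\<in>Suc ` {..K}. 1 / (real i)\<^sup>2)"
      by (subst sum.reindex) auto
    also have "Suc ` {..K} = insert 1 {1<..Suc K}"
    proof -
      have "i \<in> Suc ` {..K}" if "1 \<le> i" "i \<le> Suc K" for i
        using that by (intro image_eqI[of _ _ "i - 1"]) auto
      then show ?thesis by fastforce
    qed
    finally show ?thesis by simp
  qed
  also have "(\<Sum>i\<in>{1<..Suc K}. 1 / (real i)\<^sup>2) \<le> 1 / real 1 - 1 / real (Suc K)"
    by (rule sum_inverse_squares_le) auto
  also have "\<dots> \<le> 1"
    by simp
  finally show ?thesis by simp
qed

text \<open>For \<open>\<bar>y\<bar> \<le> 1.6\<close> the cubic Maclaurin error takes less than
  half of \<open>\<bar>y\<bar>\<close>, as \<open>1.6 * 1.6 / 6 < 1 / 2\<close>. The estimate serves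
  points close to an integer, where a deleted zero has to offset a small sine.\<close>

lemma abs_sin_pi_ge:
  assumes "\<bar>u\<bar> \<le> 1 / 2"
  shows "\<bar>u\<bar> \<le> \<bar>sin (pi * u)\<bar>"
proof -
  define y where "y = pi * u"
  have "pi \<le> 3.2"
    using pi_approx by simp
  have y: "\<bar>y\<bar> \<le> 1.6"
    unfolding y_def abs_mult using mult_mono[of pi "3.2" "\<bar>u\<bar>" "1 / 2"] assms \<open>pi \<le> 3.2\<close> by simp
  have "\<bar>sin y - y\<bar> \<le> \<bar>y\<bar> ^ 3 / 6"
    using Maclaurin_sin_bound[of y 3] by (simp add: eval_nat_numeral sin_coeff_def)
  also have "\<bar>y\<bar> ^ 3 / 6 = \<bar>y\<bar> * (\<bar>y\<bar> * \<bar>y\<bar> / 6)"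
    by (simp add: eval_nat_numeral)
  also have "\<dots> \<le> \<bar>y\<bar> * (1.6 * 1.6 / 6)"
    using y by (intro mult_left_mono divide_right_mono mult_mono) auto
  finally have "\<bar>sin y\<bar> \<ge> \<bar>y\<bar> / 2"
    by (auto simp: abs_if split: if_splits)
  moreover have "2 * \<bar>u\<bar> \<le> pi * \<bar>u\<bar>"
    using pi_ge_two by (intro mult_right_mono) auto
  ultimately show ?thesis
    by (simp add: y_def abs_mult)
qed

text \<open>
  The factor of \<open>b\<^sub>n\<close> that comes from moving the zero \<open>s\<close> to \<open>z\<close> is a cross ratio; the integers \<open>s = q\<close>
  and \<open>s = n\<close>, where it degenerates, are covered by the convention for the weights.
\<close>

lemma pair_factor_le:
  fixes \<nu> z L \<delta> :: real and n q s :: int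
  assumes q: "\<bar>\<nu> - of_int q\<bar> \<le> 1 / 2" and z: "\<bar>\<nu> - z\<bar> \<ge> \<delta>" and s: "\<bar>of_int s - z\<bar> \<le> L"
    and "\<delta> > 0" "L \<ge> 0"
  shows "\<bar>of_int n - z\<bar> * (if s = q then 1 else \<bar>\<nu> - of_int s\<bar>) /
      (\<bar>\<nu> - z\<bar> * max 1 (of_int \<bar>n - s\<bar>)) \<le>
    1 + (2 * L + 1) * (1 + (L + 2) / \<delta>) *
      ((of_int \<bar>n - q\<bar> + 1) / (max 1 (of_int \<bar>n - s\<bar>) * max 1 (of_int \<bar>q - s\<bar>)))"
proof -
  define D where "D = \<bar>\<nu> - z\<bar>"
  define u where "u = max 1 (real_of_int \<bar>q - s\<bar>)"
  define \<eta> where "\<eta> = max 1 (real_of_int \<bar>n - s\<bar>)"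
  define w where "w = real_of_int \<bar>n - q\<bar> + 1"
  define C where "C = 1 + (L + 2) / \<delta>"
  define \<omega> where "\<omega> = (if s = q then 1 else \<bar>\<nu> - of_int s\<bar>)"
  have pos: "D > 0" "u > 0" "\<eta> > 0" "w > 0" "D \<ge> \<delta>" "\<eta> \<ge> 1"
    using assms by (auto simp: D_def u_def \<eta>_def w_def)
  \<comment> \<open>Since \<open>D \<ge> \<delta>\<close>, the additive bound for \<open>u\<close>
    becomes the multiple \<open>D * C\<close>, which lets \<open>1 / D\<close> be replaced by
    \<open>C / u\<close> below.\<close>
  have "real_of_int \<bar>q - s\<bar> \<le> D + L + 2"
    unfolding D_def using q s by linarith
  then have "u \<le> D + L + 2"
    using pos assms by (auto simp: u_def)
  also have "\<dots> = D + \<delta> * ((L + 2) / \<delta>)"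
    using assms by simp
  also have "\<dots> \<le> D + D * ((L + 2) / \<delta>)"
    using pos assms by (intro add_left_mono mult_right_mono) auto
  finally have u: "u \<le> D * C"
    by (simp add: C_def distrib_left)
  have num: "\<bar>of_int n - z\<bar> * \<omega> \<le> D * \<eta> + (2 * L + 1) * w"
  proof (cases "s = q")
    case True
    have "\<bar>of_int n - z\<bar> \<le> w + L"
      unfolding w_def using s True by linarith
    also have "\<dots> \<le> w + L * w"
      using assms pos mult_left_mono[of 1 w L] by (simp add: w_def)
    also have "\<dots> \<le> D * \<eta> + (2 * L + 1) * w"
      using assms pos by (simp add: distrib_right)
    finally show ?thesis
      using True by (simp add: \<omega>_def)
  next
    case False
    \<comment> \<open>The three-term relation for four points on a line: the first product gives the
      main term 1 of the quotient, and the second is small because \<open>z\<close> is within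
      \<open>L\<close> of \<open>s\<close>.\<close>
    have eq: "(of_int n - z) * (\<nu> - of_int s) =
        (\<nu> - z) * (of_int n - of_int s) + (of_int n - \<nu>) * (z - of_int s)"
      by (simp add: algebra_simps)
    have "\<bar>of_int n - z\<bar> * \<omega> = \<bar>(of_int n - z) * (\<nu> - of_int s)\<bar>"
      using False by (simp add: \<omega>_def abs_mult)
    also have "\<dots> \<le> \<bar>(\<nu> - z) * (of_int n - of_int s)\<bar> + \<bar>(of_int n - \<nu>) * (z - of_int s)\<bar>"
      unfolding eq by (rule abs_triangle_ineq)
    also have "\<dots> = D * \<bar>of_int n - of_int s\<bar> + \<bar>of_int n - \<nu>\<bar> * \<bar>z - of_int s\<bar>"
      by (simp add: abs_mult D_def)
    also have "\<dots> \<le> D * \<eta> + w * L"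
    proof (intro add_mono mult_mono)
      show "\<bar>of_int n - of_int s\<bar> \<le> \<eta>"
        by (simp add: \<eta>_def)
      show "\<bar>of_int n - \<nu>\<bar> \<le> w"
        unfolding w_def using q by linarith
      show "\<bar>z - of_int s\<bar> \<le> L"
        using s by linarith
    qed (use pos in auto)
    also have "\<dots> \<le> D * \<eta> + (2 * L + 1) * w"
      using assms pos by (simp add: algebra_simps)
    finally show ?thesis .
  qed
  have "\<bar>of_int n - z\<bar> * \<omega> / (D * \<eta>) \<le> (D * \<eta> + (2 * L + 1) * w) / (D * \<eta>)"
    using num pos by (intro divide_right_mono) auto
  also have "\<dots> = 1 + (2 * L + 1) * (w / (D * \<eta>))"
    using pos by (simp add: add_divide_distrib)
  also have "w / (D * \<eta>) \<le> C * (w / (\<eta> * u))"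
  proof -
    have "w / (D * \<eta>) = w * u / (D * \<eta> * u)"
      using pos by simp
    also have "\<dots> \<le> w * (D * C) / (D * \<eta> * u)"
      using u pos by (intro divide_right_mono mult_left_mono) auto
    also have "\<dots> = C * (w / (\<eta> * u))"
      using pos by simp
    finally show ?thesis .
  qed
  finally show ?thesis
    using assms by (simp add: D_def u_def \<eta>_def w_def C_def \<omega>_def mult.assoc)
qed

text \<open>\<open>g\<close> lists the last integers of \<open>N\<close> consecutive blocks,
  beginning with the block that contains \<open>q\<close>.\<close>

lemma card_residue_class_ge:
  fixes q :: int and L N :: nat
  assumes "L \<ge> 1"
  shows "card {l\<in>{q - int (N * L)..q + int (N * L)}. l mod int L = int L - 1} \<ge> N"
proof -
  define g where "g i = int L * (q div int L + int i) + (int L - 1)" for i :: nat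
  have "g ` {..<N} \<subseteq> {l\<in>{q - int (N * L)..q + int (N * L)}. l mod int L = int L - 1}"
  proof
    fix l assume "l \<in> g ` {..<N}"
    then obtain i where i: "i < N" "l = g i" by auto
    have "l = (int L * (q div int L) + q mod int L) + int L * int i + (int L - 1 - q mod int L)"
      by (simp add: i g_def algebra_simps)
    then have l: "l = q + int L * int i + (int L - 1 - q mod int L)"
      by simp
    have "0 \<le> q mod int L" "q mod int L < int L"
      using assms by auto
    moreover have "int L * int i + int L \<le> int (N * L)"
    proof -
      have "int L * (int i + 1) \<le> int L * int N"
        using i by (intro mult_left_mono) auto
      then show ?thesis by (simp add: algebra_simps)
    qed
    moreover have "0 \<le> int L * int i" "0 \<le> int (N * L)"
      by auto
    ultimately have "q - int (N * L) \<le> l" "l \<le> q + int (N * L)"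
      unfolding l by linarith+
    moreover have "l mod int L = int L - 1"
      unfolding i(2) g_def mod_mult_self4 using assms by (intro mod_pos_pos_trivial) auto
    ultimately show "l \<in> {l\<in>{q - int (N * L)..q + int (N * L)}. l mod int L = int L - 1}"
      by simp
  qed
  moreover have "inj_on g {..<N}"
    using assms by (auto simp: inj_on_def g_def)
  ultimately have "card {..<N} \<le> card {l\<in>{q - int (N * L)..q + int (N * L)}. l mod int L = int L - 1}"
    by (intro card_inj_on_le) (auto intro: finite_subset[OF _ finite_atLeastAtMost_int])
  then show ?thesis by simp
qed

section \<open>Interpolating functions with quadratically decaying coefficients\<close>

text \<open>A condition on the first \<open>m\<close> points only, so that estimates can depend on
  \<open>L\<close> and \<open>\<delta>\<close> but not on \<open>m\<close>.\<close>

definition well_spaced :: "nat \<Rightarrow> real \<Rightarrow> nat \<Rightarrow> (nat \<Rightarrow> real) \<Rightarrow> bool" where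
  "well_spaced L \<delta> m \<mu> \<longleftrightarrow>
     (\<forall>a. card {k\<in>{..<m}. \<mu> k \<in> {a..a + real L}} < L) \<and>
     (\<forall>i<m. \<forall>j<m. i \<noteq> j \<longrightarrow> \<bar>\<mu> i - \<mu> j\<bar> \<ge> \<delta>)"

text \<open>
  \<open>b\<close> are the coefficients of a function \<open>F(x) = \<Sum>n. b n * sincpi (x - n)\<close> with \<open>F(\<mu>\<^sub>j) = \<delta>\<^sub>j\<^sub>k\<close>.
\<close>

definition lattice_coeffs ::
    "real \<Rightarrow> nat \<Rightarrow> (nat \<Rightarrow> real) \<Rightarrow> nat \<Rightarrow> int set \<Rightarrow> (int \<Rightarrow> real) \<Rightarrow> bool" where
  "lattice_coeffs C m \<mu> k S b \<longleftrightarrow> finite S \<and>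
     (\<forall>j<m. (\<Sum>n\<in>S. b n * sincpi (\<mu> j - of_int n)) = (if j = k then 1 else 0)) \<and>
     (\<forall>n. \<bar>b n\<bar> \<le> C / (1 + of_int \<bar>n - round (\<mu> k)\<bar>)\<^sup>2) \<and> (\<forall>n. n \<notin> S \<longrightarrow> b n = 0)"

text \<open>The interpolant is the sine with the zeros in \<open>S\<close> deleted and new zeros put
  at the other points. Non-integral points keep the partial fractions free of poles at every
  \<open>\<mu> j\<close>. The constant is uniform in \<open>m\<close>, \<open>\<mu>\<close> and
  \<open>k\<close>.\<close>

lemma lattice_coeffs_exist:
  fixes L :: nat and \<delta> :: real
  assumes L: "L \<ge> 1" and \<delta>: "\<delta> > 0"
  obtains C where "C > 0"
    "\<And>m \<mu> k. \<lbrakk>well_spaced L \<delta> m \<mu>; \<forall>k<m. \<mu> k \<notin> \<int>; k < m\<rbrakk> \<Longrightarrow> \<exists>S b. lattice_coeffs C m \<mu> k S b"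
proof -
  \<comment> \<open>\<open>C1\<close> is the constant of \<open>pair_factor_le\<close>. The moved
    zeros cost growth of order \<open>8 * C1 \<le> N - 2\<close>, so \<open>N\<close> deleted zeros
    leave quadratic decay. The window of radius \<open>R\<close> contains that many free integers,
    and \<open>D\<close> bounds the numerator of each deleted factor.\<close>
  define C1 where "C1 = (2 * real L + 1) * (1 + (real L + 2) / \<delta>)"
  define N where "N = nat \<lceil>8 * C1\<rceil> + 2"
  define R where "R = N * L"
  define D where "D = (real R + 1) * (real R + 2)"
  define C where "C = pi * exp (36 * C1) * D ^ (2 * R + 1)"
  have C1: "C1 \<ge> 0"
    using \<delta> by (simp add: C1_def)
  have N: "8 * C1 \<le> real (N - 2)" "N \<ge> 2"
    by (simp_all add: N_def) linarith
  have D: "D \<ge> 1"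
    by (simp add: D_def algebra_simps)
  show ?thesis
  proof
    show "C > 0"
      using D by (simp add: C_def)
    fix m k :: nat and \<mu> :: "nat \<Rightarrow> real"
    assume "well_spaced L \<delta> m \<mu>" and "\<forall>k<m. \<mu> k \<notin> \<int>" and k: "k < m"
    then have count: "\<And>a. card {k\<in>{..<m}. \<mu> k \<in> {a..a + real L}} < L"
      and sep: "\<And>i j. i < m \<Longrightarrow> j < m \<Longrightarrow> i \<noteq> j \<Longrightarrow> \<bar>\<mu> i - \<mu> j\<bar> \<ge> \<delta>"
      and nonint: "\<And>k. k < m \<Longrightarrow> \<mu> k \<notin> \<int>"
      by (simp_all add: well_spaced_def)
    obtain \<sigma> where inj: "inj_on \<sigma> {..<m}" and near: "\<And>k. k < m \<Longrightarrow> \<bar>of_int (\<sigma> k) - \<mu> k\<bar> \<le> real L"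
      and md: "\<And>k. k < m \<Longrightarrow> \<sigma> k mod int L \<noteq> int L - 1"
      using block_matching[OF L count] by metis
    define J where "J = {..<m} - {k}"
    define q where "q = round (\<mu> k)"
    \<comment> \<open>\<open>E\<close> collects the unmatched integers of the window; they are
      deleted as zeros with no replacement.\<close>
    define E where "E = {q - int R..q + int R} - \<sigma> ` J"
    define S where "S = \<sigma> ` J \<union> E"
    define \<omega> where "\<omega> s = (if s = q then 1 else \<bar>\<mu> k - of_int s\<bar>)" for s :: int
    define P where "P = (\<Prod>j\<in>J. \<mu> k - \<mu> j)"
    define Q where "Q = (\<Prod>s\<in>S. \<mu> k - of_int s)"
    define c where "c n = (\<Prod>j\<in>J. of_int n - \<mu> j) / (\<Prod>s\<in>S - {n}. of_int n - of_int s)" for n :: int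
    \<comment> \<open>By partial fractions \<open>b\<close> are the coefficients of
      \<open>F(x) = (\<kappa> / \<pi>) * sin (\<pi>x) * (\<Prod>j\<in>J. x - \<mu> j) / (\<Prod>s\<in>S. x - s)\<close>.\<close>
    define \<kappa> where "\<kappa> = pi * Q / (sin (pi * \<mu> k) * P)"
    define b where "b n = (if n \<in> S then \<kappa> * (- 1) powi n * c n else 0)" for n :: int
    have fin: "finite J" "finite E" "finite S" "finite (\<sigma> ` J)"
      by (auto simp: J_def E_def S_def)
    have injJ: "inj_on \<sigma> J"
      using inj by (rule inj_on_subset) (auto simp: J_def)
    have q: "\<bar>\<mu> k - of_int q\<bar> \<le> 1 / 2"
      using of_int_round_abs_le[of "\<mu> k"] by (simp add: q_def abs_minus_commute)
    \<comment> \<open>The residue class avoided by \<open>\<sigma>\<close> is unmatched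
      throughout.\<close>
    have "{l\<in>{q - int (N * L)..q + int (N * L)}. l mod int L = int L - 1} \<subseteq> E"
      using md by (auto simp: E_def R_def J_def)
    then have "card {l\<in>{q - int (N * L)..q + int (N * L)}. l mod int L = int L - 1} \<le> card E"
      using fin by (intro card_mono)
    then have card_E: "N \<le> card E"
      using card_residue_class_ge[OF L, of N q] by linarith
    have "card E \<le> card {q - int R..q + int R}"
      unfolding E_def by (intro card_mono) auto
    then have card_E': "card E \<le> 2 * R + 1"
      by simp
    have "card S = card (\<sigma> ` J) + card E"
      unfolding S_def using fin by (intro card_Un_disjoint) (auto simp: E_def)
    then have card_S: "card J < card S"
      using card_E N(2) card_image[OF injJ] by simp
    have not_lattice: "\<mu> j \<noteq> of_int n" if "j < m" for j n
      using nonint[OF that] by auto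
    have sin_nz: "sin (pi * \<mu> k) \<noteq> 0"
      using nonint[OF k] sin_times_pi_eq_0[of "\<mu> k"] by (simp add: mult.commute)
    have P: "P \<noteq> 0"
    proof -
      have "\<mu> k \<noteq> \<mu> j" if "j \<in> J" for j
        using sep[of k j] that k \<delta> by (auto simp: J_def)
      then show ?thesis
        using fin by (auto simp: P_def)
    qed
    have Q: "Q \<noteq> 0"
      using fin not_lattice[OF k] by (auto simp: Q_def)

    have interp: "(\<Sum>n\<in>S. b n * sincpi (\<mu> j - of_int n)) = (if j = k then 1 else 0)" if j: "j < m" for j
    proof -
      have "(\<Sum>n\<in>S. b n * sincpi (\<mu> j - of_int n)) =
          (\<Sum>n\<in>S. \<kappa> * sin (pi * \<mu> j) / pi * (c n / (\<mu> j - of_int n)))"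
      proof (rule sum.cong)
        fix n assume n: "n \<in> S"
        have sgn: "(- 1 :: real) powi n * (- 1) powi n = 1"
          by (simp flip: power_int_mult_distrib)
        have "b n * sincpi (\<mu> j - of_int n) =
            ((- 1) powi n * (- 1) powi n) * (\<kappa> * sin (pi * \<mu> j) / pi * (c n / (\<mu> j - of_int n)))"
          using n not_lattice[OF j] by (simp add: b_def sincpi_diff_int del: power_int_minus_one_mult_self power_int_minus_one_mult_self')
        then show "b n * sincpi (\<mu> j - of_int n) = \<kappa> * sin (pi * \<mu> j) / pi * (c n / (\<mu> j - of_int n))"
          by (simp only: sgn mult_1)
      qed simp
      also have "\<dots> = \<kappa> * sin (pi * \<mu> j) / pi * (\<Sum>n\<in>S. c n / (\<mu> j - of_int n))"
        by (simp add: sum_distrib_left)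
      also have "(\<Sum>n\<in>S. c n / (\<mu> j - of_int n)) =
          (\<Prod>i\<in>J. \<mu> j - \<mu> i) / (\<Prod>s\<in>S. \<mu> j - of_int s)"
        unfolding c_def using fin card_S not_lattice[OF j]
        by (intro lagrange_partial_fractions [symmetric]) auto
      finally have eq: "(\<Sum>n\<in>S. b n * sincpi (\<mu> j - of_int n)) =
          \<kappa> * sin (pi * \<mu> j) / pi * ((\<Prod>i\<in>J. \<mu> j - \<mu> i) / (\<Prod>s\<in>S. \<mu> j - of_int s))" .
      show ?thesis
      proof (cases "j = k")
        case True
        then show ?thesis
          unfolding eq \<kappa>_def using sin_nz P Q by (simp add: P_def Q_def)
      next
        case False
        then have "j \<in> J"
          using j by (simp add: J_def)
        then have "(\<Prod>i\<in>J. \<mu> j - \<mu> i) = 0"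
          using fin by (auto intro: prod_zero)
        with False show ?thesis
          unfolding eq by simp
      qed
    qed

    have bound: "\<bar>b n\<bar> \<le> C / (1 + of_int \<bar>n - q\<bar>)\<^sup>2" if n: "n \<in> S" for n
    proof -
      define \<eta> where "\<eta> s = max 1 (real_of_int \<bar>n - s\<bar>)" for s
      define p where "p = real_of_int \<bar>n - q\<bar>"
      have p: "p \<ge> 0"
        by (simp add: p_def)
      have \<eta>_pos: "\<eta> s > 0" for s
        by (simp add: \<eta>_def less_max_iff_disj)
      have \<omega>_nonneg: "\<omega> s \<ge> 0" for s
        by (simp add: \<omega>_def)
      \<comment> \<open>Because of \<open>max 1\<close> the factor at \<open>s = n\<close> is one,
        so the excluded index may be put back.\<close>
      have prod_\<eta>: "\<bar>\<Prod>s\<in>S - {n}. real_of_int n - of_int s\<bar> = prod \<eta> S"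
      proof -
        have "\<eta> n = 1"
          by (simp add: \<eta>_def)
        then have "prod \<eta> S = prod \<eta> (S - {n})"
          using fin n by (simp add: prod.remove)
        also have "\<dots> = (\<Prod>s\<in>S - {n}. \<bar>real_of_int n - of_int s\<bar>)"
        proof (rule prod.cong)
          fix s assume "s \<in> S - {n}"
          then have "\<bar>n - s\<bar> \<ge> 1" by auto
          then have "real_of_int \<bar>n - s\<bar> \<ge> 1" by linarith
          then show "\<eta> s = \<bar>real_of_int n - of_int s\<bar>"
            by (simp add: \<eta>_def)
        qed simp
        finally show ?thesis
          by (simp add: abs_prod)
      qed
      \<comment> \<open>The integer \<open>q\<close> nearest to \<open>\<mu> k\<close> always belongs to \<open>S\<close>, and its factor in \<open>Q\<close> compensates
        a small value of the sine.\<close>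
      have abs_Q: "\<bar>Q\<bar> \<le> \<bar>sin (pi * \<mu> k)\<bar> * prod \<omega> S"
      proof (cases "q \<in> S")
        case True
        have "\<bar>Q\<bar> = \<bar>\<mu> k - of_int q\<bar> * (\<Prod>s\<in>S - {q}. \<bar>\<mu> k - of_int s\<bar>)"
          unfolding Q_def abs_prod by (rule prod.remove[OF fin(3) True])
        also have "(\<Prod>s\<in>S - {q}. \<bar>\<mu> k - of_int s\<bar>) = prod \<omega> (S - {q})"
          by (rule prod.cong) (auto simp: \<omega>_def)
        also have "\<dots> = prod \<omega> S"
          using fin True by (simp add: prod.remove[of S q] \<omega>_def)
        also have "\<bar>\<mu> k - of_int q\<bar> \<le> \<bar>sin (pi * (\<mu> k - of_int q))\<bar>"
          using q by (rule abs_sin_pi_ge)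
        also have "sin (pi * (\<mu> k - of_int q)) = sin (pi * \<mu> k) * cos (pi * of_int q)"
          by (simp add: right_diff_distrib sin_diff mult.commute sin_zero_iff_int2)
        also have "\<bar>\<dots>\<bar> = \<bar>sin (pi * \<mu> k)\<bar>"
          by (simp add: abs_mult mult.commute cos_npi_int)
        finally show ?thesis
          using \<omega>_nonneg by (simp add: mult_right_mono prod_nonneg)
      next
        case False
        then show ?thesis
          by (auto simp: S_def E_def)
      qed
      have "\<bar>b n\<bar> = \<bar>\<kappa>\<bar> * \<bar>c n\<bar>"
        using n by (simp add: b_def abs_mult power_int_abs [symmetric])
      also have "\<dots> \<le> pi * prod \<omega> S / \<bar>P\<bar> * \<bar>c n\<bar>"
      proof (rule mult_right_mono)
        have "\<bar>\<kappa>\<bar> = pi * \<bar>Q\<bar> / (\<bar>sin (pi * \<mu> k)\<bar> * \<bar>P\<bar>)"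
          by (simp add: \<kappa>_def abs_mult)
        also have "\<dots> \<le> pi * (\<bar>sin (pi * \<mu> k)\<bar> * prod \<omega> S) / (\<bar>sin (pi * \<mu> k)\<bar> * \<bar>P\<bar>)"
          using abs_Q by (intro divide_right_mono mult_left_mono) auto
        also have "\<dots> = pi * prod \<omega> S / \<bar>P\<bar>"
          using sin_nz by simp
        finally show "\<bar>\<kappa>\<bar> \<le> pi * prod \<omega> S / \<bar>P\<bar>" .
      qed simp
      also have "\<bar>c n\<bar> = \<bar>\<Prod>j\<in>J. of_int n - \<mu> j\<bar> / prod \<eta> S"
        by (simp add: c_def prod_\<eta>)
      \<comment> \<open>The factors over \<open>S\<close> are regrouped: each
        \<open>\<sigma> j\<close> is paired with its \<open>\<mu> j\<close>, and the deleted
        integers \<open>E\<close> remain.\<close>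
      also have "pi * prod \<omega> S / \<bar>P\<bar> * (\<bar>\<Prod>j\<in>J. of_int n - \<mu> j\<bar> / prod \<eta> S) =
          pi * ((\<Prod>j\<in>J. \<bar>of_int n - \<mu> j\<bar> * \<omega> (\<sigma> j) / (\<bar>\<mu> k - \<mu> j\<bar> * \<eta> (\<sigma> j))) * (\<Prod>e\<in>E. \<omega> e / \<eta> e))"
      proof -
        have split: "prod h S = (\<Prod>j\<in>J. h (\<sigma> j)) * prod h E" for h :: "int \<Rightarrow> real"
        proof -
          have "prod h S = prod h (\<sigma> ` J) * prod h E"
            unfolding S_def using fin by (intro prod.union_disjoint) (auto simp: E_def)
          then show ?thesis
            using injJ by (simp add: prod.reindex)
        qed
        show ?thesis
          unfolding split P_def abs_prod prod_dividef prod.distrib by (simp add: mult_ac)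
      qed
      also have "\<dots> \<le> pi * (exp (36 * C1) * (1 + p) ^ (N - 2) * (D ^ (2 * R + 1) / (1 + p) ^ N))"
      proof (intro mult_left_mono mult_mono)
        define t where "t s = (p + 1) / (max 1 (real_of_int \<bar>n - s\<bar>) * max 1 (real_of_int \<bar>q - s\<bar>))" for s
        have t_nonneg: "t s \<ge> 0" for s
          using p by (simp add: t_def)
        \<comment> \<open>By \<open>1 + x \<le> exp x\<close> the product of paired factors is at
          most the exponential of a convolution sum, which grows logarithmically in
          \<open>p\<close>.\<close>
        have "(\<Prod>j\<in>J. \<bar>of_int n - \<mu> j\<bar> * \<omega> (\<sigma> j) / (\<bar>\<mu> k - \<mu> j\<bar> * \<eta> (\<sigma> j))) \<le>
            (\<Prod>j\<in>J. exp (C1 * t (\<sigma> j)))"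
        proof (rule prod_mono)
          fix j assume j: "j \<in> J"
          have "\<bar>of_int n - \<mu> j\<bar> * \<omega> (\<sigma> j) / (\<bar>\<mu> k - \<mu> j\<bar> * \<eta> (\<sigma> j)) \<le> 1 + C1 * t (\<sigma> j)"
            unfolding \<omega>_def \<eta>_def C1_def t_def p_def
            using q sep[of k j] near[of j] \<delta> j k by (intro pair_factor_le) (auto simp: J_def)
          also have "\<dots> \<le> exp (C1 * t (\<sigma> j))"
            by (rule exp_ge_add_one_self)
          finally show "0 \<le> \<bar>of_int n - \<mu> j\<bar> * \<omega> (\<sigma> j) / (\<bar>\<mu> k - \<mu> j\<bar> * \<eta> (\<sigma> j)) \<and>
              \<bar>of_int n - \<mu> j\<bar> * \<omega> (\<sigma> j) / (\<bar>\<mu> k - \<mu> j\<bar> * \<eta> (\<sigma> j)) \<le> exp (C1 * t (\<sigma> j))"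
            using \<omega>_nonneg \<eta>_pos by (simp add: less_imp_le)
        qed
        also have "\<dots> = exp (C1 * (\<Sum>j\<in>J. t (\<sigma> j)))"
          using fin by (simp add: exp_sum sum_distrib_left)
        also have "(\<Sum>j\<in>J. t (\<sigma> j)) = sum t (\<sigma> ` J)"
          using injJ by (simp add: sum.reindex)
        also have "\<dots> = (\<Sum>l\<in>(\<lambda>s. s - q) ` \<sigma> ` J. (of_int \<bar>n - q\<bar> + 1) /
            (max 1 (of_int \<bar>(n - q) - l\<bar>) * max 1 (of_int \<bar>l\<bar>)))"
          by (subst sum.reindex) (auto simp: inj_on_def t_def p_def abs_minus_commute)
        also have "C1 * \<dots> \<le> C1 * (36 + 8 * ln (1 + p))"
          unfolding p_def using C1 fin by (intro mult_left_mono sum_convolution_le_ln) auto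
        also have "\<dots> \<le> 36 * C1 + real (N - 2) * ln (1 + p)"
        proof -
          have "8 * C1 * ln (1 + p) \<le> real (N - 2) * ln (1 + p)"
            using N p by (intro mult_right_mono) auto
          then show ?thesis by (simp add: algebra_simps)
        qed
        also have "exp (36 * C1 + real (N - 2) * ln (1 + p)) = exp (36 * C1) * (1 + p) ^ (N - 2)"
          using p by (simp add: exp_add exp_of_nat_mult)
        finally show "(\<Prod>j\<in>J. \<bar>of_int n - \<mu> j\<bar> * \<omega> (\<sigma> j) / (\<bar>\<mu> k - \<mu> j\<bar> * \<eta> (\<sigma> j))) \<le>
            exp (36 * C1) * (1 + p) ^ (N - 2)"
          by simp
        \<comment> \<open>Deleted integers lie within \<open>R\<close> of \<open>q\<close>, so their
          distance from \<open>n\<close> is comparable to \<open>p\<close> and each gains a factor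
          \<open>1 / (1 + p)\<close>.\<close>
        have "(\<Prod>e\<in>E. \<omega> e / \<eta> e) \<le> (\<Prod>e\<in>E. D / (1 + p))"
        proof (rule prod_mono)
          fix e assume e: "e \<in> E"
          have "\<bar>e - q\<bar> \<le> int R"
            using e by (auto simp: E_def)
          then have e: "real_of_int \<bar>e - q\<bar> \<le> real R" by linarith
          then have "\<bar>\<mu> k - of_int e\<bar> \<le> real R + 1"
            using q by linarith
          then have \<omega>: "\<omega> e \<le> real R + 1"
            by (simp add: \<omega>_def)
          have "p \<le> real_of_int \<bar>n - e\<bar> + real_of_int \<bar>e - q\<bar>"
            unfolding p_def by linarith
          moreover have "real_of_int \<bar>n - e\<bar> \<le> \<eta> e" "1 \<le> \<eta> e"
            by (auto simp: \<eta>_def)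
          ultimately have "1 + p \<le> \<eta> e + (real R + 1)"
            using e by linarith
          also have "real R + 1 \<le> \<eta> e * (real R + 1)"
            using mult_right_mono[OF \<open>1 \<le> \<eta> e\<close>, of "real R + 1"] by simp
          finally have "1 + p \<le> \<eta> e * (real R + 2)"
            by (simp add: algebra_simps)
          then have "\<omega> e * (1 + p) \<le> (real R + 1) * (\<eta> e * (real R + 2))"
            using \<omega> \<omega>_nonneg p by (intro mult_mono) auto
          then have "\<omega> e / \<eta> e \<le> D / (1 + p)"
            using \<eta>_pos[of e] p by (simp add: D_def divide_simps mult_ac)
          then show "0 \<le> \<omega> e / \<eta> e \<and> \<omega> e / \<eta> e \<le> D / (1 + p)"
            using \<omega>_nonneg \<eta>_pos by (simp add: less_imp_le)
        qed
        also have "\<dots> = D ^ card E / (1 + p) ^ card E"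
          by (simp add: power_divide)
        \<comment> \<open>The upper bound for \<open>card E\<close> serves the numerator and the
          lower bound the denominator, both bases being at least one.\<close>
        also have "\<dots> \<le> D ^ (2 * R + 1) / (1 + p) ^ N"
          using D p card_E card_E' by (intro frac_le power_increasing) auto
        finally show "(\<Prod>e\<in>E. \<omega> e / \<eta> e) \<le> D ^ (2 * R + 1) / (1 + p) ^ N" .
        show "0 \<le> (\<Prod>e\<in>E. \<omega> e / \<eta> e)"
          using \<omega>_nonneg \<eta>_pos by (intro prod_nonneg) (simp add: less_imp_le)
      qed (use p in auto)
      also have "\<dots> = C / (1 + p)\<^sup>2"
      proof -
        have "(1 + p) ^ N = (1 + p) ^ (N - 2) * (1 + p)\<^sup>2"
          using N(2) by (simp only: power_add [symmetric] le_add_diff_inverse2)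
        then show ?thesis
          using p by (simp add: C_def)
      qed
      finally show ?thesis
        by (simp add: p_def)
    qed
    have "lattice_coeffs C m \<mu> k S b"
      unfolding lattice_coeffs_def
    proof (intro conjI allI impI)
      fix n
      show "\<bar>b n\<bar> \<le> C / (1 + of_int \<bar>n - round (\<mu> k)\<bar>)\<^sup>2"
      proof (cases "n \<in> S")
        case True
        then show ?thesis
          using bound by (simp add: q_def)
      next
        case False
        then show ?thesis
          using \<open>C > 0\<close> by (simp add: b_def)
      qed
    qed (use interp fin in \<open>auto simp: b_def\<close>)
    then show "\<exists>S b. lattice_coeffs C m \<mu> k S b"
      by blast
  qed
qed

section \<open>Lower bound of the Gram form by duality\<close>

text \<open>Cauchy-Schwarz with the weight \<open>\<bar>b i n\<bar>\<close> split into two square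
  roots.\<close>

lemma schur_test:
  fixes b :: "'i \<Rightarrow> 'j \<Rightarrow> real" and \<xi> :: "'i \<Rightarrow> real"
  assumes rows: "\<And>i. i \<in> I \<Longrightarrow> (\<Sum>n\<in>T. \<bar>b i n\<bar>) \<le> A" and cols: "\<And>n. n \<in> T \<Longrightarrow> (\<Sum>i\<in>I. \<bar>b i n\<bar>) \<le> B"
    and "B \<ge> 0"
  shows "(\<Sum>n\<in>T. (\<Sum>i\<in>I. \<xi> i * b i n)\<^sup>2) \<le> A * B * (\<Sum>i\<in>I. (\<xi> i)\<^sup>2)"
proof -
  have "(\<Sum>i\<in>I. \<xi> i * b i n)\<^sup>2 \<le> B * (\<Sum>i\<in>I. (\<xi> i)\<^sup>2 * \<bar>b i n\<bar>)" if n: "n \<in> T" for n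
  proof -
    have "\<bar>\<Sum>i\<in>I. \<xi> i * b i n\<bar> \<le> (\<Sum>i\<in>I. sqrt \<bar>b i n\<bar> * (\<bar>\<xi> i\<bar> * sqrt \<bar>b i n\<bar>))"
      by (intro order_trans[OF sum_abs] sum_mono) (simp add: abs_mult mult_ac)
    then have "(\<Sum>i\<in>I. \<xi> i * b i n)\<^sup>2 \<le> (\<Sum>i\<in>I. sqrt \<bar>b i n\<bar> * (\<bar>\<xi> i\<bar> * sqrt \<bar>b i n\<bar>))\<^sup>2"
      using power_mono[of "\<bar>\<Sum>i\<in>I. \<xi> i * b i n\<bar>" _ 2] by simp
    also have "\<dots> \<le> (\<Sum>i\<in>I. (sqrt \<bar>b i n\<bar>)\<^sup>2) * (\<Sum>i\<in>I. (\<bar>\<xi> i\<bar> * sqrt \<bar>b i n\<bar>)\<^sup>2)"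
      by (rule Cauchy_Schwarz_ineq_sum)
    also have "\<dots> = (\<Sum>i\<in>I. \<bar>b i n\<bar>) * (\<Sum>i\<in>I. (\<xi> i)\<^sup>2 * \<bar>b i n\<bar>)"
      by (simp add: power_mult_distrib)
    also have "\<dots> \<le> B * (\<Sum>i\<in>I. (\<xi> i)\<^sup>2 * \<bar>b i n\<bar>)"
      using cols[OF n] by (intro mult_right_mono sum_nonneg) auto
    finally show ?thesis .
  qed
  then have "(\<Sum>n\<in>T. (\<Sum>i\<in>I. \<xi> i * b i n)\<^sup>2) \<le> (\<Sum>n\<in>T. B * (\<Sum>i\<in>I. (\<xi> i)\<^sup>2 * \<bar>b i n\<bar>))"
    by (rule sum_mono)
  also have "\<dots> = B * (\<Sum>i\<in>I. (\<xi> i)\<^sup>2 * (\<Sum>n\<in>T. \<bar>b i n\<bar>))"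
    by (simp add: sum_distrib_left [symmetric]) (simp add: sum_distrib_left sum.swap[of _ I T])
  also have "\<dots> \<le> B * (\<Sum>i\<in>I. (\<xi> i)\<^sup>2 * A)"
    using rows \<open>B \<ge> 0\<close> by (intro mult_left_mono sum_mono) auto
  finally show ?thesis
    by (simp add: sum_distrib_left mult_ac)
qed

text \<open>The functions dual to the translates are combined with coefficients
  \<open>\<xi>\<close>. Their sum has squared norm at most \<open>K * E\<close> by Schur's test,
  while its pairing with the combination of translates is exactly \<open>E\<close>.\<close>

lemma gram_lower_bound_nonint:
  fixes L :: nat and \<delta> :: real
  assumes L: "L \<ge> 1" and \<delta>: "\<delta> > 0"
  shows "\<exists>K>0. \<forall>m \<mu> \<xi>. well_spaced L \<delta> m \<mu> \<longrightarrow> (\<forall>k<m. \<mu> k \<notin> \<int>) \<longrightarrow>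
       (\<Sum>k<m. (\<xi> k)\<^sup>2) \<le> K * (\<Sum>i<m. \<Sum>j<m. \<xi> i * \<xi> j * sincpi (\<mu> i - \<mu> j))"
proof -
  obtain C where C: "C > 0" and coeffs:
    "\<And>m \<mu> k. \<lbrakk>well_spaced L \<delta> m \<mu>; \<forall>k<m. \<mu> k \<notin> \<int>; k < m\<rbrakk> \<Longrightarrow> \<exists>S b. lattice_coeffs C m \<mu> k S b"
    using lattice_coeffs_exist[OF assms] by metis
  define A where "A = 4 * C"
  define B where "B = real L * (4 * C)"
  define K where "K = A * B"
  have pos: "A > 0" "B > 0" "K > 0"
    using C L by (simp_all add: A_def B_def K_def)
  show ?thesis
  proof (intro exI conjI allI impI)
    fix m :: nat and \<mu> \<xi> :: "nat \<Rightarrow> real"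
    assume ws: "well_spaced L \<delta> m \<mu>" and nonint: "\<forall>k<m. \<mu> k \<notin> \<int>"
    then have count: "\<And>a. card {k\<in>{..<m}. \<mu> k \<in> {a..a + real L}} < L"
      by (simp add: well_spaced_def)
    have "\<forall>k. \<exists>S b. k < m \<longrightarrow> lattice_coeffs C m \<mu> k S b"
      using coeffs[OF ws nonint] by metis
    then obtain S b where b: "\<And>k. k < m \<Longrightarrow> lattice_coeffs C m \<mu> k (S k) (b k)"
      by metis
    define T where "T = (\<Union>k<m. S k)"
    have finT: "finite T"
      using b by (auto simp: T_def lattice_coeffs_def)
    have interp: "(\<Sum>n\<in>T. b k n * sincpi (\<mu> j - of_int n)) = (if j = k then 1 else 0)"
      if "k < m" "j < m" for j k
    proof -
      have "(\<Sum>n\<in>T. b k n * sincpi (\<mu> j - of_int n)) = (\<Sum>n\<in>S k. b k n * sincpi (\<mu> j - of_int n))"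
        using that b[of k] finT by (intro sum.mono_neutral_right) (auto simp: T_def lattice_coeffs_def)
      then show ?thesis
        using that b[of k] by (simp add: lattice_coeffs_def)
    qed
    have b_le: "\<bar>b k n\<bar> \<le> C * (1 / (1 + of_int \<bar>n - round (\<mu> k)\<bar>)\<^sup>2)" if "k < m" for k n
      using that b[of k] by (simp add: lattice_coeffs_def)
    have rows: "(\<Sum>n\<in>T. \<bar>b k n\<bar>) \<le> A" if "k \<in> {..<m}" for k
    proof -
      have "(\<Sum>n\<in>T. \<bar>b k n\<bar>) \<le> (\<Sum>n\<in>T. C * (1 / (1 + of_int \<bar>n - round (\<mu> k)\<bar>)\<^sup>2))"
        using that b_le by (intro sum_mono) auto
      also have "\<dots> \<le> C * 4"
        unfolding sum_distrib_left [symmetric]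
        using C finT by (intro mult_left_mono sum_int_inverse_square_Suc_le) auto
      finally show ?thesis by (simp add: A_def)
    qed
    have cols: "(\<Sum>k\<in>{..<m}. \<bar>b k n\<bar>) \<le> B" for n
    proof -
      define g where "g v = 1 / (1 + real_of_int \<bar>v - n\<bar>)\<^sup>2" for v
      have g: "g v \<ge> 0" for v
        by (simp add: g_def)
      \<comment> \<open>Points with the same nearest integer lie in an interval of length one, hence
        number fewer than \<open>L\<close>.\<close>
      have fibre: "(\<Sum>k\<in>{k \<in> {..<m}. round (\<mu> k) = v}. g (round (\<mu> k))) \<le> real L * g v" for v
      proof -
        have "{k \<in> {..<m}. round (\<mu> k) = v} \<subseteq>
            {k\<in>{..<m}. \<mu> k \<in> {of_int v - 1 / 2..of_int v - 1 / 2 + real L}}"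
        proof safe
          fix k assume "k < m" "v = round (\<mu> k)"
          then have "\<bar>of_int v - \<mu> k\<bar> \<le> 1 / 2"
            using of_int_round_abs_le by blast
          moreover have "real L \<ge> 1"
            using L by simp
          ultimately show "\<mu> k \<in> {of_int (round (\<mu> k)) - 1 / 2..of_int (round (\<mu> k)) - 1 / 2 + real L}"
            unfolding \<open>v = round (\<mu> k)\<close> atLeastAtMost_iff by linarith
        qed
        then have "card {k \<in> {..<m}. round (\<mu> k) = v} \<le>
            card {k\<in>{..<m}. \<mu> k \<in> {of_int v - 1 / 2..of_int v - 1 / 2 + real L}}"
          by (intro card_mono) auto
        then have "card {k \<in> {..<m}. round (\<mu> k) = v} \<le> L"
          using count[of "of_int v - 1 / 2"] by linarith
        then show ?thesis
          using g by (simp add: mult_right_mono)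
      qed
      have "(\<Sum>k\<in>{..<m}. \<bar>b k n\<bar>) \<le> (\<Sum>k\<in>{..<m}. C * g (round (\<mu> k)))"
        using b_le by (intro sum_mono) (auto simp: g_def abs_minus_commute)
      also have "\<dots> = C * (\<Sum>k\<in>{..<m}. g (round (\<mu> k)))"
        by (simp add: sum_distrib_left)
      also have "(\<Sum>k\<in>{..<m}. g (round (\<mu> k))) =
          (\<Sum>v\<in>(\<lambda>k. round (\<mu> k)) ` {..<m}. \<Sum>k\<in>{k \<in> {..<m}. round (\<mu> k) = v}. g (round (\<mu> k)))"
        by (rule sum.image_gen) simp
      also have "\<dots> \<le> (\<Sum>v\<in>(\<lambda>k. round (\<mu> k)) ` {..<m}. real L * g v)"
        by (intro sum_mono fibre)
      also have "\<dots> \<le> real L * 4"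
        unfolding sum_distrib_left [symmetric] g_def
        by (intro mult_left_mono sum_int_inverse_square_Suc_le) auto
      finally show ?thesis
        using C by (simp add: B_def mult_ac)
    qed
    define \<beta> where "\<beta> n = (\<Sum>k<m. \<xi> k * b k n)" for n
    define E where "E = (\<Sum>k<m. (\<xi> k)\<^sup>2)"
    have \<beta>: "(\<Sum>n\<in>T. (\<beta> n)\<^sup>2) \<le> K * E"
      unfolding \<beta>_def K_def E_def using rows cols pos by (intro schur_test) auto
    have "(\<Sum>j<m. \<Sum>n\<in>T. \<xi> j * \<beta> n * sincpi (\<mu> j - of_int n)) =
        (\<Sum>j<m. \<xi> j * (\<Sum>k<m. \<xi> k * (\<Sum>n\<in>T. b k n * sincpi (\<mu> j - of_int n))))"
      unfolding \<beta>_def sum_distrib_left sum_distrib_right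
      by (intro sum.cong refl, subst sum.swap) (simp add: mult_ac)
    also have "\<dots> = (\<Sum>j<m. \<xi> j * (\<Sum>k<m. if j = k then \<xi> k else 0))"
      using interp by (intro sum.cong refl arg_cong2[of _ _ _ _ "(*)"]) auto
    also have "\<dots> = E"
      by (simp add: E_def power2_eq_square)
    finally have cross: "(\<Sum>j<m. \<Sum>n\<in>T. \<xi> j * \<beta> n * sincpi (\<mu> j - of_int n)) = E" .
    define G where "G = (\<Sum>i<m. \<Sum>j<m. \<xi> i * \<xi> j * sincpi (\<mu> i - \<mu> j))"
    \<comment> \<open>With the scale \<open>1 / K\<close> the cross term is
      \<open>- 2 * E / K\<close> and the square at most \<open>E / K\<close>.\<close>
    have "0 \<le> G + 2 * (\<Sum>j<m. \<Sum>n\<in>T. \<xi> j * (- (\<beta> n / K)) * sincpi (\<mu> j - of_int n)) +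
        (\<Sum>n\<in>T. (- (\<beta> n / K))\<^sup>2)"
      unfolding G_def using finT by (intro sincpi_psd_int) auto
    also have "(\<Sum>j<m. \<Sum>n\<in>T. \<xi> j * (- (\<beta> n / K)) * sincpi (\<mu> j - of_int n)) = - (E / K)"
      unfolding cross [symmetric] by (simp add: sum_divide_distrib sum_negf)
    also have "(\<Sum>n\<in>T. (- (\<beta> n / K))\<^sup>2) = (\<Sum>n\<in>T. (\<beta> n)\<^sup>2) / K\<^sup>2"
      by (simp add: sum_divide_distrib power_divide)
    also have "\<dots> \<le> K * E / K\<^sup>2"
      using \<beta> by (intro divide_right_mono) auto
    also have "\<dots> = E / K"
      using pos by (simp add: power2_eq_square)
    finally have "E / K \<le> G"
      by simp
    then show "(\<Sum>k<m. (\<xi> k)\<^sup>2) \<le> K * (\<Sum>i<m. \<Sum>j<m. \<xi> i * \<xi> j * sincpi (\<mu> i - \<mu> j))"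
      using pos by (simp add: E_def G_def field_simps)
  qed (fact pos)
qed

text \<open>The form depends only on differences, so a translation avoiding countably many values
  makes all points non-integral.\<close>

lemma gram_lower_bound:
  fixes L :: nat and \<delta> :: real
  assumes L: "L \<ge> 1" and \<delta>: "\<delta> > 0"
  shows "\<exists>K>0. \<forall>m \<mu> \<xi>. well_spaced L \<delta> m \<mu> \<longrightarrow>
       (\<Sum>k<m. (\<xi> k)\<^sup>2) \<le> K * (\<Sum>i<m. \<Sum>j<m. \<xi> i * \<xi> j * sincpi (\<mu> i - \<mu> j))"
proof -
  obtain K where K: "K > 0" and bound:
    "\<forall>m \<mu> \<xi>. well_spaced L \<delta> m \<mu> \<longrightarrow> (\<forall>k<m. \<mu> k \<notin> \<int>) \<longrightarrow>
       (\<Sum>k<m. (\<xi> k)\<^sup>2) \<le> K * (\<Sum>i<m. \<Sum>j<m. \<xi> i * \<xi> j * sincpi (\<mu> i - \<mu> j))"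
    using gram_lower_bound_nonint[OF assms] by blast
  show ?thesis
  proof (intro exI conjI allI impI)
    fix m :: nat and \<mu> \<xi> :: "nat \<Rightarrow> real"
    assume ws: "well_spaced L \<delta> m \<mu>"
    have "countable ((\<lambda>(k, n). \<mu> k - of_int n) ` ({..<m} \<times> (UNIV :: int set)))"
      by auto
    then obtain \<theta> where \<theta>: "\<theta> \<notin> (\<lambda>(k, n). \<mu> k - of_int n) ` ({..<m} \<times> (UNIV :: int set))"
      by (metis UNIV_eq_I uncountable_UNIV_real)
    define \<nu> where "\<nu> k = \<mu> k - \<theta>" for k
    have "(\<Sum>k<m. (\<xi> k)\<^sup>2) \<le> K * (\<Sum>i<m. \<Sum>j<m. \<xi> i * \<xi> j * sincpi (\<nu> i - \<nu> j))"
    proof (rule bound [rule_format])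
      have "{k\<in>{..<m}. \<nu> k \<in> {a..a + real L}} = {k\<in>{..<m}. \<mu> k \<in> {a + \<theta>..a + \<theta> + real L}}" for a
        by (auto simp: \<nu>_def)
      then show "well_spaced L \<delta> m \<nu>"
        using ws by (simp add: well_spaced_def) (simp add: \<nu>_def)
      show "\<nu> k \<notin> \<int>" if "k < m" for k
      proof
        assume "\<nu> k \<in> \<int>"
        then obtain n where "\<mu> k - \<theta> = of_int n"
          by (auto simp: \<nu>_def elim: Ints_cases)
        then have "\<theta> = (\<lambda>(k, n). \<mu> k - of_int n) (k, n)"
          by simp
        with \<theta> \<open>k < m\<close> show False by blast
      qed
    qed
    then show "(\<Sum>k<m. (\<xi> k)\<^sup>2) \<le> K * (\<Sum>i<m. \<Sum>j<m. \<xi> i * \<xi> j * sincpi (\<mu> i - \<mu> j))"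
      by (simp add: \<nu>_def)
  qed (fact K)
qed

section \<open>Comparison with the integer lattice\<close>

text \<open>Elimination of one index at a time: the Schur complement \<open>G'\<close> is again
  symmetric and positive definite.\<close>

lemma positive_definite_solvable:
  fixes G :: "'i \<Rightarrow> 'i \<Rightarrow> real"
  assumes "finite I" "\<And>i j. G i j = G j i"
    and "\<And>x. \<exists>i\<in>I. x i \<noteq> 0 \<Longrightarrow> (\<Sum>i\<in>I. \<Sum>j\<in>I. x i * x j * G i j) > 0"
  shows "\<exists>h. \<forall>i\<in>I. (\<Sum>j\<in>I. G i j * h j) = b i"
  using assms
proof (induction I arbitrary: G b rule: finite_induct)
  case (insert p I G b)
  have sum_upd: "(\<Sum>i\<in>I. F i ((h(p := t)) i)) = (\<Sum>i\<in>I. F i (h i))"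
    for F :: "'i \<Rightarrow> real \<Rightarrow> real" and h t
    using insert.hyps by (intro sum.cong) auto
  have pp: "G p p > 0"
  proof -
    have "(\<Sum>j\<in>I. (if i = p then 1 else 0) * (if j = p then 1 else 0) * G i j) = 0" for i
      using insert.hyps by (intro sum.neutral) auto
    moreover have "(\<Sum>i\<in>I. (if i = p then 1 else 0) * G i p) = 0"
      using insert.hyps by (intro sum.neutral) auto
    ultimately show ?thesis
      using insert.prems(2)[of "\<lambda>i. if i = p then 1 else 0"] insert.hyps by simp
  qed
  define G' where "G' i j = G i j - G i p * G p j / G p p" for i j
  have "\<exists>h. \<forall>i\<in>I. (\<Sum>j\<in>I. G' i j * h j) = b i - G i p * b p / G p p"
  proof (rule insert.IH)
    show "G' i j = G' j i" for i j
      by (simp add: G'_def insert.prems(1)[of i j] insert.prems(1)[of i p] insert.prems(1)[of j p])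
    fix x :: "'i \<Rightarrow> real" assume nz: "\<exists>i\<in>I. x i \<noteq> 0"
    define s where "s = (\<Sum>j\<in>I. G p j * x j)"
    \<comment> \<open>The value at \<open>p\<close> minimises the form, and the minimum is the form
      of \<open>G'\<close> at \<open>x\<close>.\<close>
    define y where "y = x(p := - (s / G p p))"
    have "\<exists>i\<in>insert p I. y i \<noteq> 0"
      using nz insert.hyps by (auto simp: y_def)
    then have "0 < (\<Sum>i\<in>insert p I. \<Sum>j\<in>insert p I. y i * y j * G i j)"
      by (rule insert.prems(2))
    also have "\<dots> = y p * y p * G p p + y p * (\<Sum>j\<in>I. G p j * y j) + y p * (\<Sum>i\<in>I. G p i * y i)
        + (\<Sum>i\<in>I. \<Sum>j\<in>I. y i * y j * G i j)"
    proof -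
      have "(\<Sum>i\<in>I. y i * y p * G i p) = y p * (\<Sum>i\<in>I. G p i * y i)"
        by (simp add: insert.prems(1)[of _ p] sum_distrib_left mult_ac)
      moreover have "(\<Sum>j\<in>I. y p * y j * G p j) = y p * (\<Sum>j\<in>I. G p j * y j)"
        by (simp add: sum_distrib_left mult_ac)
      ultimately show ?thesis
        using insert.hyps by (simp add: sum.distrib)
    qed
    also have "(\<Sum>j\<in>I. G p j * y j) = s"
      unfolding y_def s_def by (rule sum_upd)
    also have "(\<Sum>i\<in>I. \<Sum>j\<in>I. y i * y j * G i j) = (\<Sum>i\<in>I. \<Sum>j\<in>I. x i * x j * G i j)"
      using insert.hyps by (intro sum.cong) (auto simp: y_def)
    also have "y p * y p * G p p + y p * s + y p * s + \<dots> =
        (\<Sum>i\<in>I. \<Sum>j\<in>I. x i * x j * G i j) - s * s / G p p"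
      using pp by (simp add: y_def field_simps)
    also have "s * s / G p p = (\<Sum>i\<in>I. \<Sum>j\<in>I. x i * x j * (G i p * G p j / G p p))"
      unfolding s_def sum_product sum_divide_distrib
    proof (intro sum.cong refl)
      fix i j
      show "G p i * x i * (G p j * x j) / G p p = x i * x j * (G i p * G p j / G p p)"
        by (simp add: insert.prems(1)[of i p])
    qed
    also have "(\<Sum>i\<in>I. \<Sum>j\<in>I. x i * x j * G i j) - \<dots> = (\<Sum>i\<in>I. \<Sum>j\<in>I. x i * x j * G' i j)"
      by (simp add: G'_def sum_subtractf right_diff_distrib)
    finally show "0 < (\<Sum>i\<in>I. \<Sum>j\<in>I. x i * x j * G' i j)" .
  qed
  then obtain h where h: "\<And>i. i \<in> I \<Longrightarrow> (\<Sum>j\<in>I. G' i j * h j) = b i - G i p * b p / G p p"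
    by blast
  define s where "s = (\<Sum>j\<in>I. G p j * h j)"
  define g where "g = h(p := (b p - s) / G p p)"
  have g: "(\<Sum>j\<in>insert p I. G i j * g j) = G i p * ((b p - s) / G p p) + (\<Sum>j\<in>I. G i j * h j)" for i
    using insert.hyps sum_upd[of "\<lambda>j t. G i j * t"] by (simp add: g_def)
  have "(\<Sum>j\<in>insert p I. G i j * g j) = b i" if i: "i \<in> insert p I" for i
  proof (cases "i = p")
    case True
    then show ?thesis
      using pp by (simp add: g s_def)
  next
    case False
    then have "i \<in> I"
      using i by simp
    have "(\<Sum>j\<in>I. G' i j * h j) = (\<Sum>j\<in>I. G i j * h j) - (\<Sum>j\<in>I. G i p * G p j / G p p * h j)"
      by (simp add: G'_def left_diff_distrib sum_subtractf)
    also have "(\<Sum>j\<in>I. G i p * G p j / G p p * h j) = G i p * s / G p p"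
      by (simp add: s_def sum_distrib_left sum_divide_distrib mult_ac)
    finally have "(\<Sum>j\<in>I. G' i j * h j) = (\<Sum>j\<in>I. G i j * h j) - G i p * s / G p p" .
    with h[OF \<open>i \<in> I\<close>] show ?thesis
      by (simp add: g right_diff_distrib diff_divide_distrib)
  qed
  then show ?case by blast
qed simp

text \<open>The form of \<open>H\<close> at \<open>h\<close> minus \<open>\<tau>\<close> times the
  \<open>k\<close>-th unit vector is nonnegative: Cauchy-Schwarz with a free scale.\<close>

lemma psd_cross_le:
  fixes H :: "'i \<Rightarrow> 'i \<Rightarrow> real"
  assumes "finite I" "k \<in> I" "\<And>i j. H i j = H j i"
    and psd: "\<And>x. 0 \<le> (\<Sum>i\<in>I. \<Sum>j\<in>I. x i * x j * H i j)"
  shows "2 * \<tau> * (\<Sum>i\<in>I. H k i * h i) \<le> (\<Sum>i\<in>I. \<Sum>j\<in>I. h i * h j * H i j) + \<tau>\<^sup>2 * H k k"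
proof -
  define d where "d i = (if i = k then 1 else 0 :: real)" for i
  have d1: "(\<Sum>i\<in>I. d i * F i) = F k" for F
  proof -
    have "(\<Sum>i\<in>I. d i * F i) = (\<Sum>i\<in>I. if i = k then F i else 0)"
      by (intro sum.cong) (auto simp: d_def)
    then show ?thesis
      using assms(1,2) by simp
  qed
  have col: "(\<Sum>i\<in>I. h i * H i k) = (\<Sum>i\<in>I. H k i * h i)"
    by (simp add: assms(3)[of _ k] mult.commute)
  have "(\<Sum>i\<in>I. \<Sum>j\<in>I. (h i - \<tau> * d i) * (h j - \<tau> * d j) * H i j) =
      (\<Sum>i\<in>I. \<Sum>j\<in>I. h i * h j * H i j) - \<tau> * (\<Sum>i\<in>I. h i * (\<Sum>j\<in>I. d j * H i j))
      - \<tau> * (\<Sum>i\<in>I. d i * (\<Sum>j\<in>I. H i j * h j)) + \<tau>\<^sup>2 * (\<Sum>i\<in>I. d i * (\<Sum>j\<in>I. d j * H i j))"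
    by (simp add: algebra_simps sum.distrib sum_subtractf sum_distrib_left power2_eq_square)
  also have "\<dots> = (\<Sum>i\<in>I. \<Sum>j\<in>I. h i * h j * H i j) - 2 * \<tau> * (\<Sum>i\<in>I. H k i * h i) + \<tau>\<^sup>2 * H k k"
    unfolding d1 by (simp add: col)
  finally show ?thesis
    using psd[of "\<lambda>i. h i - \<tau> * d i"] by simp
qed

text \<open>With \<open>a\<close> as the matrix of lattice coefficients, \<open>H\<close> is the
  Gram matrix of the residuals after projection onto the lattice functions from \<open>W\<close>.
  The trace of the inverse of \<open>G\<close> times \<open>a\<close> times its transpose is at most
  \<open>card W\<close>, summed over \<open>n\<close>, and at least
  \<open>card I * (1 - \<eta>)\<close>, summed over the points.\<close>

lemma card_le_of_gram_lower_bound: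
  fixes \<mu> :: "'i \<Rightarrow> real" and W :: "int set"
  assumes I: "finite I" and W: "finite W" and c: "c > 0" and \<eta>: "\<eta> > 0"
    and lower: "\<And>x. c * (\<Sum>i\<in>I. (x i)\<^sup>2) \<le> (\<Sum>i\<in>I. \<Sum>j\<in>I. x i * x j * sincpi (\<mu> i - \<mu> j))"
    and tail: "\<And>i. i \<in> I \<Longrightarrow> (\<Sum>n\<in>W. (sincpi (\<mu> i - of_int n))\<^sup>2) \<ge> 1 - c * \<eta>\<^sup>2"
  shows "real (card I) * (1 - \<eta>) \<le> real (card W)"
proof -
  define G where "G i j = sincpi (\<mu> i - \<mu> j)" for i j
  define a where "a i n = sincpi (\<mu> i - of_int n)" for i n
  define H where "H i j = G i j - (\<Sum>n\<in>W. a i n * a j n)" for i j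
  have G_sym: "G i j = G j i" for i j
    by (simp add: G_def sincpi_commute)
  have H_sym: "H i j = H j i" for i j
    by (simp add: H_def G_sym[of i j] mult.commute)
  have lower: "c * (\<Sum>i\<in>I. (x i)\<^sup>2) \<le> (\<Sum>i\<in>I. \<Sum>j\<in>I. x i * x j * G i j)" for x
    using lower by (simp add: G_def)
  have aa: "(\<Sum>i\<in>I. \<Sum>j\<in>I. x i * x j * (\<Sum>n\<in>W. a i n * a j n)) = (\<Sum>n\<in>W. (\<Sum>i\<in>I. x i * a i n)\<^sup>2)" for x
  proof -
    have "(\<Sum>n\<in>W. (\<Sum>i\<in>I. x i * a i n)\<^sup>2) = (\<Sum>n\<in>W. \<Sum>i\<in>I. \<Sum>j\<in>I. x i * x j * (a i n * a j n))"
      by (simp add: power2_eq_square sum_product mult_ac)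
    also have "\<dots> = (\<Sum>i\<in>I. \<Sum>n\<in>W. \<Sum>j\<in>I. x i * x j * (a i n * a j n))"
      by (rule sum.swap)
    also have "\<dots> = (\<Sum>i\<in>I. \<Sum>j\<in>I. \<Sum>n\<in>W. x i * x j * (a i n * a j n))"
      by (intro sum.cong refl, rule sum.swap)
    finally show ?thesis
      by (simp add: sum_distrib_left)
  qed
  have H_form: "(\<Sum>i\<in>I. \<Sum>j\<in>I. x i * x j * H i j) =
      (\<Sum>i\<in>I. \<Sum>j\<in>I. x i * x j * G i j) - (\<Sum>n\<in>W. (\<Sum>i\<in>I. x i * a i n)\<^sup>2)" for x
    by (simp add: H_def right_diff_distrib sum_subtractf aa)
  have H_psd: "0 \<le> (\<Sum>i\<in>I. \<Sum>j\<in>I. x i * x j * H i j)" for x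
  proof -
    define y where "y n = (\<Sum>i\<in>I. x i * a i n)" for n
    have "(\<Sum>i\<in>I. \<Sum>n\<in>W. x i * - y n * sincpi (\<mu> i - of_int n)) = - (\<Sum>n\<in>W. (y n)\<^sup>2)"
      by (subst sum.swap)
        (simp add: y_def a_def sum_negf power2_eq_square sum_distrib_left sum_distrib_right mult_ac)
    then show ?thesis
      using sincpi_psd_int[OF I W, of x \<mu> "\<lambda>n. - y n"] by (simp add: H_form G_def y_def)
  qed
  \<comment> \<open>The vectors \<open>h k\<close> are the columns of the inverse of
    \<open>G\<close>.\<close>
  have "\<exists>h. \<forall>i\<in>I. (\<Sum>j\<in>I. G i j * h j) = (if i = k then 1 else 0)" for k
  proof (rule positive_definite_solvable[OF I G_sym])
    fix x :: "'i \<Rightarrow> real" assume "\<exists>i\<in>I. x i \<noteq> 0"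
    then have "(\<Sum>i\<in>I. (x i)\<^sup>2) > 0"
      using I by (auto intro: sum_pos2)
    then show "0 < (\<Sum>i\<in>I. \<Sum>j\<in>I. x i * x j * G i j)"
      using lower[of x] c by (smt (verit) mult_pos_pos)
  qed
  then obtain h where h: "\<And>k i. i \<in> I \<Longrightarrow> (\<Sum>j\<in>I. G i j * h k j) = (if i = k then 1 else 0)"
    by metis

  have trace_le: "(\<Sum>i\<in>I. (\<Sum>k\<in>I. a k n * h k i) * a i n) \<le> 1" if n: "n \<in> W" for n
  proof -
    \<comment> \<open>\<open>t\<close> is the squared norm of the projection of the lattice function
      \<open>n\<close> onto the span of the translates; Bessel's inequality gives
      \<open>t * t \<le> t\<close>.\<close>
    define y where "y i = (\<Sum>k\<in>I. a k n * h k i)" for i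
    define t where "t = (\<Sum>i\<in>I. y i * a i n)"
    have Gy: "(\<Sum>j\<in>I. G i j * y j) = a i n" if i: "i \<in> I" for i
    proof -
      have "(\<Sum>j\<in>I. G i j * y j) = (\<Sum>k\<in>I. a k n * (\<Sum>j\<in>I. G i j * h k j))"
        unfolding y_def sum_distrib_left by (subst sum.swap) (simp add: mult_ac)
      also have "\<dots> = (\<Sum>k\<in>I. if k = i then a k n else 0)"
        using h[OF i] by (intro sum.cong) auto
      finally show ?thesis
        using i I by simp
    qed
    have "(\<Sum>i\<in>I. \<Sum>j\<in>I. y i * y j * G i j) = (\<Sum>i\<in>I. y i * (\<Sum>j\<in>I. G i j * y j))"
      by (simp add: sum_distrib_left mult_ac)
    also have "\<dots> = t"
      using Gy by (simp add: t_def)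
    finally have "(\<Sum>n\<in>W. (\<Sum>i\<in>I. y i * a i n)\<^sup>2) \<le> t"
      using H_psd[of y] unfolding H_form by simp
    moreover have "(\<Sum>i\<in>I. y i * a i n)\<^sup>2 \<le> (\<Sum>n\<in>W. (\<Sum>i\<in>I. y i * a i n)\<^sup>2)"
      using n W by (intro member_le_sum) auto
    ultimately have "t * t \<le> t * 1"
      by (simp add: t_def power2_eq_square)
    then have "t \<le> 1"
      using mult_le_cancel_left_pos[of t t 1] by (cases "t > 0") auto
    then show ?thesis
      by (simp add: t_def y_def)
  qed

  have diag_le: "(\<Sum>i\<in>I. H k i * h k i) \<le> \<eta>" if k: "k \<in> I" for k
  proof -
    \<comment> \<open>The diagonal entry of the inverse of \<open>G\<close> is at most
      \<open>1 / c\<close>, because the form at \<open>h k\<close> equals \<open>t\<close>.\<close>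
    define t where "t = h k k"
    have "(\<Sum>i\<in>I. \<Sum>j\<in>I. h k i * h k j * G i j) = (\<Sum>i\<in>I. h k i * (\<Sum>j\<in>I. G i j * h k j))"
      by (simp add: sum_distrib_left mult_ac)
    also have "\<dots> = (\<Sum>i\<in>I. if i = k then h k i else 0)"
      using h by (intro sum.cong) auto
    finally have form: "(\<Sum>i\<in>I. \<Sum>j\<in>I. h k i * h k j * G i j) = t"
      using k I by (simp add: t_def)
    have "t\<^sup>2 \<le> (\<Sum>i\<in>I. (h k i)\<^sup>2)"
      unfolding t_def using k I by (intro member_le_sum) auto
    then have "c * t\<^sup>2 \<le> t"
      using lower[of "h k"] form c mult_left_mono[of "t\<^sup>2" _ c] by (smt (verit))
    then have "t * (c * t) \<le> t * 1"
      by (simp add: power2_eq_square mult_ac)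
    then have "c * t \<le> 1"
      using mult_le_cancel_left_pos[of t "c * t" 1] mult_nonneg_nonpos[of c t] c
      by (cases "t > 0") auto
    then have t: "t \<le> 1 / c"
      using c by (simp add: field_simps)
    have Hkk: "H k k \<le> c * \<eta>\<^sup>2"
      using tail[OF k] by (simp add: H_def G_def a_def power2_eq_square)
    \<comment> \<open>This scale balances the two summands: both become
      \<open>1 / c\<close>.\<close>
    define \<tau> where "\<tau> = 1 / (c * \<eta>)"
    have \<tau>: "\<tau> > 0"
      using c \<eta> by (simp add: \<tau>_def)
    have "(\<Sum>i\<in>I. \<Sum>j\<in>I. h k i * h k j * H i j) \<le> t"
      unfolding H_form form by (simp add: sum_nonneg)
    then have "2 * \<tau> * (\<Sum>i\<in>I. H k i * h k i) \<le> 1 / c + \<tau>\<^sup>2 * (c * \<eta>\<^sup>2)"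
      using psd_cross_le[OF I k H_sym H_psd, of \<tau> "h k"] t Hkk
        mult_left_mono[OF Hkk, of "\<tau>\<^sup>2"] by (smt (verit) zero_le_power2)
    also have "\<dots> = 2 * \<tau> * \<eta>"
      using c \<eta> by (simp add: \<tau>_def field_simps power2_eq_square)
    finally show ?thesis
      using \<tau> by simp
  qed

  have "(\<Sum>n\<in>W. \<Sum>i\<in>I. (\<Sum>k\<in>I. a k n * h k i) * a i n) =
      (\<Sum>n\<in>W. \<Sum>k\<in>I. \<Sum>i\<in>I. (a k n * a i n) * h k i)"
    unfolding sum_distrib_right
    by (rule sum.cong[OF refl], subst sum.swap) (simp add: mult_ac)
  also have "\<dots> = (\<Sum>k\<in>I. \<Sum>n\<in>W. \<Sum>i\<in>I. (a k n * a i n) * h k i)"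
    by (rule sum.swap)
  also have "\<dots> = (\<Sum>k\<in>I. \<Sum>i\<in>I. (\<Sum>n\<in>W. a k n * a i n) * h k i)"
    unfolding sum_distrib_right by (intro sum.cong refl, rule sum.swap)
  also have "\<dots> = (\<Sum>k\<in>I. (\<Sum>i\<in>I. G k i * h k i) - (\<Sum>i\<in>I. H k i * h k i))"
    by (simp add: H_def left_diff_distrib sum_subtractf)
  also have "\<dots> \<ge> (\<Sum>k\<in>I. 1 - \<eta>)"
    using h diag_le by (intro sum_mono diff_mono) auto
  finally have "real (card I) * (1 - \<eta>) \<le> (\<Sum>n\<in>W. \<Sum>i\<in>I. (\<Sum>k\<in>I. a k n * h k i) * a i n)"
    by simp
  also have "\<dots> \<le> (\<Sum>n\<in>W. 1)"
    by (intro sum_mono trace_le)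
  finally show ?thesis by simp
qed

text \<open>\<open>N\<close> is chosen so that the energy missed beyond distance \<open>N\<close> is
  at most \<open>c * \<eta>\<^sup>2\<close>. Enlarging the interval by \<open>N\<close> on both
  sides then costs a constant independent of \<open>I\<close>, \<open>a\<close> and
  \<open>\<rho>\<close>.\<close>

lemma card_interval_le_of_gram_lower_bound:
  fixes \<mu> :: "'i \<Rightarrow> real"
  assumes c: "c > 0" and \<eta>: "\<eta> > 0"
  shows "\<exists>B. \<forall>I a \<rho>. finite I \<longrightarrow> \<mu> ` I \<subseteq> {a..a + \<rho>} \<longrightarrow> 0 \<le> \<rho> \<longrightarrow>
    (\<forall>x. c * (\<Sum>i\<in>I. (x i)\<^sup>2) \<le> (\<Sum>i\<in>I. \<Sum>j\<in>I. x i * x j * sincpi (\<mu> i - \<mu> j))) \<longrightarrow>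
    real (card I) * (1 - \<eta>) \<le> \<rho> + B"
proof -
  define N where "N = nat \<lceil>2 / (c * \<eta>\<^sup>2)\<rceil> + 2"
  have N: "N \<ge> 2" "2 / (c * \<eta>\<^sup>2) \<le> real N - 1"
    unfolding N_def by linarith+
  have "2 / (real N - 1) \<le> c * \<eta>\<^sup>2"
    using N c \<eta> by (simp add: field_simps)
  then have tail: "(\<Sum>n\<in>W. (sincpi (x - of_int n))\<^sup>2) \<ge> 1 - c * \<eta>\<^sup>2"
    if "finite W" "\<And>n. \<bar>of_int n - x\<bar> \<le> real N \<Longrightarrow> n \<in> W" for W x
    using sincpi_sum_squares_ge[OF N(1) that(1), of x] that(2) by fastforce
  show ?thesis
  proof (intro exI allI impI)
    fix I :: "'i set" and a \<rho>
    assume I: "finite I" "\<mu> ` I \<subseteq> {a..a + \<rho>}" and \<rho>: "0 \<le> \<rho>"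
      and lower: "\<forall>x. c * (\<Sum>i\<in>I. (x i)\<^sup>2) \<le> (\<Sum>i\<in>I. \<Sum>j\<in>I. x i * x j * sincpi (\<mu> i - \<mu> j))"
    define W where "W = {\<lceil>a - real N\<rceil>..\<lfloor>a + \<rho> + real N\<rfloor>}"
    have "real (card I) * (1 - \<eta>) \<le> real (card W)"
    proof (rule card_le_of_gram_lower_bound[OF I(1) _ c \<eta>])
      fix i assume "i \<in> I"
      then have "a \<le> \<mu> i" "\<mu> i \<le> a + \<rho>"
        using I(2) by auto
      then show "1 - c * \<eta>\<^sup>2 \<le> (\<Sum>n\<in>W. (sincpi (\<mu> i - of_int n))\<^sup>2)"
      proof (intro tail)
        fix n assume "\<bar>real_of_int n - \<mu> i\<bar> \<le> real N"
        with \<open>a \<le> \<mu> i\<close> \<open>\<mu> i \<le> a + \<rho>\<close> show "n \<in> W"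
          unfolding W_def atLeastAtMost_iff ceiling_le_iff le_floor_iff by linarith
      qed (simp add: W_def)
    qed (use lower in \<open>auto simp: W_def\<close>)
    also have "real (card W) \<le> \<rho> + (2 * real N + 1)"
      unfolding W_def card_atLeastAtMost_int using \<rho> by linarith
    finally show "real (card I) * (1 - \<eta>) \<le> \<rho> + (2 * real N + 1)" .
  qed
qed

section \<open>Upper density\<close>

text \<open>Fekete's lemma for real arguments. The limit is the infimum \<open>D\<close>;
  monotonicity allows \<open>x\<close> to be rounded up to a multiple of \<open>x0\<close>.\<close>

lemma fekete_real:
  fixes F :: "real \<Rightarrow> real"
  assumes sub: "\<And>x y. x > 0 \<Longrightarrow> y > 0 \<Longrightarrow> F (x + y) \<le> F x + F y"
    and mono: "\<And>x y. 0 < x \<Longrightarrow> x \<le> y \<Longrightarrow> F x \<le> F y" and nonneg: "\<And>x. F x \<ge> 0"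
  shows "\<exists>D. ((\<lambda>x. F x / x) \<longlongrightarrow> D) at_top"
proof -
  define D where "D = (INF x\<in>{0<..}. F x / x)"
  have bdd: "bdd_below ((\<lambda>x. F x / x) ` {0<..})"
    using nonneg by (auto intro!: bdd_belowI[of _ 0])
  have mult: "F (real (Suc n) * x) \<le> real (Suc n) * F x" if "x > 0" for n x
  proof (induction n)
    case (Suc n)
    have "F (real (Suc (Suc n)) * x) = F (real (Suc n) * x + x)"
      by (simp add: algebra_simps)
    also have "\<dots> \<le> F (real (Suc n) * x) + F x"
      using that by (intro sub) auto
    finally show ?case
      using Suc by (simp add: algebra_simps)
  qed simp
  have "((\<lambda>x. F x / x) \<longlongrightarrow> D) at_top"
  proof (rule order_tendstoI)
    fix a assume "a < D"
    have le: "D \<le> F x / x" if "x > 0" for x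
      unfolding D_def using that bdd by (intro cINF_lower) auto
    show "\<forall>\<^sub>F x in at_top. a < F x / x"
      using eventually_gt_at_top[of 0]
      by eventually_elim (rule less_le_trans[OF \<open>a < D\<close> le])
  next
    fix a assume "D < a"
    then have "\<exists>x\<in>{0<..}. F x / x < a"
      unfolding D_def by (subst (asm) cINF_less_iff[OF _ bdd]) auto
    then obtain x0 where x0: "x0 > 0" "F x0 / x0 < a"
      by auto
    have "((\<lambda>x. F x0 / x0 + F x0 / x) \<longlongrightarrow> F x0 / x0 + 0) at_top"
      by (intro tendsto_add tendsto_const real_tendsto_divide_at_top[OF tendsto_const] filterlim_ident)
    then have "\<forall>\<^sub>F x in at_top. F x0 / x0 + F x0 / x < a"
      using x0 by (intro order_tendstoD(2)) auto
    then show "\<forall>\<^sub>F x in at_top. F x / x < a"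
      using eventually_gt_at_top[of 0]
    proof eventually_elim
      case (elim x)
      define n where "n = nat \<lfloor>x / x0\<rfloor>"
      have "x / x0 \<ge> 0"
        using elim x0 by simp
      then have n: "real n \<le> x / x0" "x / x0 \<le> real (Suc n)"
        unfolding n_def by linarith+
      then have "x \<le> real (Suc n) * x0"
        using x0 by (simp add: field_simps)
      then have "F x \<le> F (real (Suc n) * x0)"
        using elim by (intro mono)
      also have "\<dots> \<le> real (Suc n) * F x0"
        using x0 by (intro mult)
      also have "\<dots> \<le> (x / x0 + 1) * F x0"
        using n nonneg[of x0] by (intro mult_right_mono) auto
      finally have "F x / x \<le> (x / x0 + 1) * F x0 / x"
        using elim by (intro divide_right_mono) auto
      also have "\<dots> = F x0 / x0 + F x0 / x"
        using elim x0 by (simp add: field_simps)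
      finally show ?case
        using elim by linarith
    qed
  qed
  then show ?thesis by blast
qed

text \<open>A value in \<open>nat\<close> for arithmetic; it is meaningful when the maximum is
  finite, which positive separation ensures.\<close>

definition count_points :: "(nat \<Rightarrow> real) \<Rightarrow> real \<Rightarrow> nat" where
  "count_points \<Lambda> \<rho> = the_enat (max_num_points \<Lambda> \<rho>)"

lemma separation_le:
  assumes "k \<noteq> j"
  shows "separation \<Lambda> \<le> \<bar>\<Lambda> k - \<Lambda> j\<bar>"
  unfolding separation_def using assms by (intro cInf_lower bdd_belowI[of _ 0]) auto

lemma separation_ge:
  assumes "\<And>k j. k \<noteq> j \<Longrightarrow> \<delta> \<le> \<bar>\<Lambda> k - \<Lambda> j\<bar>"
  shows "\<delta> \<le> separation \<Lambda>"
proof -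
  have "\<bar>\<Lambda> 0 - \<Lambda> 1\<bar> \<in> {\<bar>\<Lambda> k - \<Lambda> j\<bar> | k j. k \<noteq> j}"
    by (rule CollectI, intro exI[of _ 0] exI[of _ 1]) simp
  then show ?thesis
    unfolding separation_def using assms by (intro cInf_greatest) blast+
qed

text \<open>Cells of length \<open>separation \<Lambda>\<close> counted from \<open>a\<close> hold
  at most one point each.\<close>

lemma finite_points_in_interval:
  assumes "separation \<Lambda> > 0"
  shows "finite {k. \<Lambda> k \<in> {a..a + \<rho>}}"
    and "card {k. \<Lambda> k \<in> {a..a + \<rho>}} \<le> nat (\<lfloor>\<rho> / separation \<Lambda>\<rfloor> + 1)"
proof -
  define \<delta> where "\<delta> = separation \<Lambda>"
  define A where "A = {k. \<Lambda> k \<in> {a..a + \<rho>}}"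
  define g where "g k = \<lfloor>(\<Lambda> k - a) / \<delta>\<rfloor>" for k
  have \<delta>: "\<delta> > 0"
    using assms by (simp add: \<delta>_def)
  have inj: "inj_on g A"
  proof (rule inj_onI, rule ccontr)
    fix k j assume "g k = g j" "k \<noteq> j"
    then have "\<bar>(\<Lambda> k - a) / \<delta> - (\<Lambda> j - a) / \<delta>\<bar> < 1"
      unfolding g_def by linarith
    moreover have "(\<Lambda> k - a) / \<delta> - (\<Lambda> j - a) / \<delta> = (\<Lambda> k - \<Lambda> j) / \<delta>"
      by (simp add: diff_divide_distrib)
    ultimately have "\<bar>\<Lambda> k - \<Lambda> j\<bar> < \<delta>"
      using \<delta> by simp
    then show False
      using separation_le[OF \<open>k \<noteq> j\<close>, of \<Lambda>] by (simp add: \<delta>_def)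
  qed
  have sub: "g ` A \<subseteq> {0..\<lfloor>\<rho> / \<delta>\<rfloor>}"
  proof
    fix l assume "l \<in> g ` A"
    then obtain k where k: "a \<le> \<Lambda> k" "\<Lambda> k \<le> a + \<rho>" "l = g k"
      by (auto simp: A_def)
    then have "0 \<le> (\<Lambda> k - a) / \<delta>" "(\<Lambda> k - a) / \<delta> \<le> \<rho> / \<delta>"
      using \<delta> by (auto intro: divide_right_mono)
    then show "l \<in> {0..\<lfloor>\<rho> / \<delta>\<rfloor>}"
      by (auto simp: k(3) g_def intro: floor_mono)
  qed
  have "finite A"
    using sub inj by (meson finite_atLeastAtMost_int inj_on_finite)
  then show "finite {k. \<Lambda> k \<in> {a..a + \<rho>}}"
    by (simp add: A_def)
  have "card A \<le> card {0..\<lfloor>\<rho> / \<delta>\<rfloor>}"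
    using sub inj by (intro card_inj_on_le) auto
  then show "card {k. \<Lambda> k \<in> {a..a + \<rho>}} \<le> nat (\<lfloor>\<rho> / separation \<Lambda>\<rfloor> + 1)"
    by (simp add: A_def \<delta>_def)
qed

lemma max_num_points_le:
  assumes "separation \<Lambda> > 0" "\<And>a. card {k. \<Lambda> k \<in> {a..a + \<rho>}} \<le> K"
  shows "max_num_points \<Lambda> \<rho> \<le> enat K"
  unfolding max_num_points_def num_points_def
  using assms finite_points_in_interval(1)[OF assms(1)] by (intro SUP_least) simp

lemma max_num_points_eq:
  assumes "separation \<Lambda> > 0"
  shows "max_num_points \<Lambda> \<rho> = enat (count_points \<Lambda> \<rho>)"
proof -
  have "max_num_points \<Lambda> \<rho> \<le> enat (nat (\<lfloor>\<rho> / separation \<Lambda>\<rfloor> + 1))"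
    using finite_points_in_interval(2)[OF assms] by (intro max_num_points_le assms)
  then obtain i where "max_num_points \<Lambda> \<rho> = enat i"
    using enat_ile by blast
  then show ?thesis
    by (simp add: count_points_def)
qed

lemma card_le_count_points:
  assumes "separation \<Lambda> > 0"
  shows "card {k. \<Lambda> k \<in> {a..a + \<rho>}} \<le> count_points \<Lambda> \<rho>"
proof -
  have "num_points \<Lambda> {a..a + \<rho>} \<le> max_num_points \<Lambda> \<rho>"
    unfolding max_num_points_def by (rule SUP_upper) simp
  then show ?thesis
    using finite_points_in_interval(1)[OF assms] max_num_points_eq[OF assms]
    by (simp add: num_points_def)
qed

lemma count_points_le:
  assumes "separation \<Lambda> > 0" "\<And>a. card {k. \<Lambda> k \<in> {a..a + \<rho>}} \<le> K"
  shows "count_points \<Lambda> \<rho> \<le> K"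
  using max_num_points_le[OF assms] max_num_points_eq[OF assms(1)] by simp

text \<open>Cutting an interval in two shows that the count is subadditive, so Fekete's lemma makes
  the \<open>Lim\<close> in \<open>upper_density\<close> a genuine finite limit.\<close>

lemma upper_density_limit:
  assumes sep: "separation \<Lambda> > 0"
  obtains D where "upper_density \<Lambda> = ereal D"
    "((\<lambda>\<rho>. real (count_points \<Lambda> \<rho>) / \<rho>) \<longlongrightarrow> D) at_top"
proof -
  have "\<exists>D. ((\<lambda>\<rho>. real (count_points \<Lambda> \<rho>) / \<rho>) \<longlongrightarrow> D) at_top"
  proof (rule fekete_real)
    fix x y :: real assume xy: "x > 0" "y > 0"
    have "count_points \<Lambda> (x + y) \<le> count_points \<Lambda> x + count_points \<Lambda> y"
    proof (rule count_points_le[OF sep])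
      fix a
      have "{k. \<Lambda> k \<in> {a..a + (x + y)}} \<subseteq> {k. \<Lambda> k \<in> {a..a + x}} \<union> {k. \<Lambda> k \<in> {a + x..a + x + y}}"
        by auto
      then have "card {k. \<Lambda> k \<in> {a..a + (x + y)}} \<le>
          card ({k. \<Lambda> k \<in> {a..a + x}} \<union> {k. \<Lambda> k \<in> {a + x..a + x + y}})"
        using finite_points_in_interval(1)[OF sep] by (intro card_mono) auto
      also have "\<dots> \<le> card {k. \<Lambda> k \<in> {a..a + x}} + card {k. \<Lambda> k \<in> {a + x..a + x + y}}"
        by (rule card_Un_le)
      also have "\<dots> \<le> count_points \<Lambda> x + count_points \<Lambda> y"
        by (intro add_mono card_le_count_points sep)
      finally show "card {k. \<Lambda> k \<in> {a..a + (x + y)}} \<le> count_points \<Lambda> x + count_points \<Lambda> y" .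
    qed
    then show "real (count_points \<Lambda> (x + y)) \<le> real (count_points \<Lambda> x) + real (count_points \<Lambda> y)"
      by linarith
  next
    fix x y :: real assume xy: "0 < x" "x \<le> y"
    have "count_points \<Lambda> x \<le> count_points \<Lambda> y"
    proof (rule count_points_le[OF sep])
      fix a
      have "{k. \<Lambda> k \<in> {a..a + x}} \<subseteq> {k. \<Lambda> k \<in> {a..a + y}}"
        using xy by auto
      then have "card {k. \<Lambda> k \<in> {a..a + x}} \<le> card {k. \<Lambda> k \<in> {a..a + y}}"
        using finite_points_in_interval(1)[OF sep] by (intro card_mono)
      also have "\<dots> \<le> count_points \<Lambda> y"
        by (rule card_le_count_points[OF sep])
      finally show "card {k. \<Lambda> k \<in> {a..a + x}} \<le> count_points \<Lambda> y" .
    qed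
    then show "real (count_points \<Lambda> x) \<le> real (count_points \<Lambda> y)"
      by simp
  qed simp
  then obtain D where D: "((\<lambda>\<rho>. real (count_points \<Lambda> \<rho>) / \<rho>) \<longlongrightarrow> D) at_top"
    by blast
  have "((\<lambda>\<rho>. ereal_of_enat (max_num_points \<Lambda> \<rho>) / ereal \<rho>) \<longlongrightarrow> ereal D) at_top"
  proof (rule Lim_transform_eventually)
    show "((\<lambda>\<rho>. ereal (real (count_points \<Lambda> \<rho>) / \<rho>)) \<longlongrightarrow> ereal D) at_top"
      using D by simp
    show "\<forall>\<^sub>F \<rho> in at_top. ereal (real (count_points \<Lambda> \<rho>) / \<rho>) =
        ereal_of_enat (max_num_points \<Lambda> \<rho>) / ereal \<rho>"
      using eventually_gt_at_top[of 0]
      by eventually_elim (simp add: max_num_points_eq[OF sep])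
  qed
  then have "upper_density \<Lambda> = ereal D"
    unfolding upper_density_def by (intro tendsto_Lim) auto
  with D that show ?thesis by blast
qed

section \<open>Reduction to a real quadratic form\<close>

text \<open>For a symmetric real kernel the mixed terms of real and imaginary parts cancel.\<close>

lemma complex_form_eq:
  fixes g :: "nat \<Rightarrow> nat \<Rightarrow> real"
  assumes "\<And>k j. g k j = g j k"
  shows "(\<Sum>k<m. \<Sum>j<m. \<xi> k * cnj (\<xi> j) * complex_of_real (g k j)) =
    complex_of_real ((\<Sum>k<m. \<Sum>j<m. Re (\<xi> k) * Re (\<xi> j) * g k j) +
      (\<Sum>k<m. \<Sum>j<m. Im (\<xi> k) * Im (\<xi> j) * g k j))"
proof (rule complex_eqI)
  have "(\<Sum>k<m. \<Sum>j<m. Im (\<xi> k) * Re (\<xi> j) * g k j) = (\<Sum>k<m. \<Sum>j<m. Re (\<xi> k) * Im (\<xi> j) * g k j)"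
    by (subst sum.swap, intro sum.cong refl) (simp add: assms mult_ac)
  then show "Im (\<Sum>k<m. \<Sum>j<m. \<xi> k * cnj (\<xi> j) * complex_of_real (g k j)) =
    Im (complex_of_real ((\<Sum>k<m. \<Sum>j<m. Re (\<xi> k) * Re (\<xi> j) * g k j) +
      (\<Sum>k<m. \<Sum>j<m. Im (\<xi> k) * Im (\<xi> j) * g k j)))"
    by (simp add: left_diff_distrib sum_subtractf)
qed (simp add: distrib_right sum.distrib)

text \<open>Quantifies how near to one the kernel is for close points, which forces separation in
  the necessity part.\<close>

lemma sincpi_ge: "1 - (pi * x)\<^sup>2 / 6 \<le> sincpi x"
proof (cases "x = 0")
  case False
  define y where "y = \<bar>pi * x\<bar>"
  have y: "y > 0"
    using False by (simp add: y_def)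
  have "\<bar>sin y - y\<bar> \<le> y ^ 3 / 6"
    using Maclaurin_sin_bound[of y 3] y by (simp add: eval_nat_numeral sin_coeff_def)
  then have "y - y ^ 3 / 6 \<le> sin y"
    using abs_le_D2 by fastforce
  then have "(y - y ^ 3 / 6) / y \<le> sin y / y"
    using y by (intro divide_right_mono) auto
  also have "(y - y ^ 3 / 6) / y = 1 - y\<^sup>2 / 6"
    using y by (simp add: field_simps eval_nat_numeral)
  also have "sin y / y = sincpi x"
    using False Omega3_abs[of "pi * x"] by (simp add: sincpi_def Omega3_def y_def)
  finally show ?thesis
    by (simp add: y_def)
qed simp

text \<open>Positive definiteness on the whole space always holds here, so only the lower bound
  remains, with the same \<open>c\<close> for real and for complex coefficients.\<close>

lemma strongly_positive_definite_sinc_iff: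
  fixes \<Lambda> :: "nat \<Rightarrow> real" and X :: "nat \<Rightarrow> real ^ 3" and f :: "real ^ 3 \<Rightarrow> complex"
  assumes r: "r > 0" and X: "\<And>k. X k = vector [0, 0, \<Lambda> k]"
    and f: "\<And>x. f x = complex_of_real (Omega3 (r * norm x))"
  shows "strongly_positive_definite X f \<longleftrightarrow>
    (\<exists>c>0. \<forall>(m::nat) x :: nat \<Rightarrow> real. c * (\<Sum>k<m. (x k)\<^sup>2) \<le>
       (\<Sum>k<m. \<Sum>j<m. x k * x j * sincpi (r / pi * \<Lambda> k - r / pi * \<Lambda> j)))"
proof -
  have pd: "positive_definite f"
    unfolding positive_definite_def
  proof (intro allI)
    fix m and x :: "nat \<Rightarrow> real ^ 3" and \<xi> :: "nat \<Rightarrow> complex"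
    define g where "g k j = Omega3 (r * norm (x k - x j))" for k j
    have "0 \<le> (\<Sum>k<m. \<Sum>j<m. a k * a j * g k j)" for a :: "nat \<Rightarrow> real"
      using Omega3_norm_psd[where x = "\<lambda>k. r *\<^sub>R x k" and a = a and I = "{..<m}"] r
      by (simp add: g_def flip: scaleR_diff_right)
    then show "0 \<le> (\<Sum>k<m. \<Sum>j<m. \<xi> k * cnj (\<xi> j) * f (x k - x j))"
      using complex_form_eq[where g = g and \<xi> = \<xi> and m = m]
      by (simp add: f g_def norm_minus_commute less_eq_complex_def)
  qed
  define G where "G k j = sincpi (r / pi * \<Lambda> k - r / pi * \<Lambda> j)" for k j
  have fG: "f (X k - X j) = complex_of_real (G k j)" for k j
  proof -
    have "pi * (r / pi * \<Lambda> k - r / pi * \<Lambda> j) = r * (\<Lambda> k - \<Lambda> j)"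
      by (simp add: right_diff_distrib)
    then show ?thesis
      using r Omega3_abs[of "r * (\<Lambda> k - \<Lambda> j)"]
      by (simp add: f X norm_axis3 G_def sincpi_def abs_mult)
  qed
  have form: "(\<Sum>k<m. \<Sum>j<m. \<xi> k * cnj (\<xi> j) * f (X k - X j)) =
    complex_of_real ((\<Sum>k<m. \<Sum>j<m. Re (\<xi> k) * Re (\<xi> j) * G k j) +
      (\<Sum>k<m. \<Sum>j<m. Im (\<xi> k) * Im (\<xi> j) * G k j))" for m \<xi>
    unfolding fG by (rule complex_form_eq) (simp add: G_def sincpi_commute)
  have "(\<forall>(m::nat) \<xi>. complex_of_real (c * (\<Sum>k<m. (cmod (\<xi> k))\<^sup>2)) \<le>
        (\<Sum>k<m. \<Sum>j<m. \<xi> k * cnj (\<xi> j) * f (X k - X j))) \<longleftrightarrow>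
      (\<forall>(m::nat) x. c * (\<Sum>k<m. (x k)\<^sup>2) \<le> (\<Sum>k<m. \<Sum>j<m. x k * x j * G k j))"
    (is "?L \<longleftrightarrow> ?R") for c :: real
  proof
    assume L: ?L
    show ?R
    proof (intro allI)
      fix m and x :: "nat \<Rightarrow> real"
      show "c * (\<Sum>k<m. (x k)\<^sup>2) \<le> (\<Sum>k<m. \<Sum>j<m. x k * x j * G k j)"
        using L[rule_format, where m = m and \<xi> = "\<lambda>k. complex_of_real (x k)"]
        unfolding form by (simp add: less_eq_complex_def)
    qed
  next
    assume R: ?R
    show ?L
    proof (intro allI)
      fix m and \<xi> :: "nat \<Rightarrow> complex"
      show "complex_of_real (c * (\<Sum>k<m. (cmod (\<xi> k))\<^sup>2)) \<le>
          (\<Sum>k<m. \<Sum>j<m. \<xi> k * cnj (\<xi> j) * f (X k - X j))"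
        using R[rule_format, where m = m and x = "\<lambda>k. Re (\<xi> k)"]
          R[rule_format, where m = m and x = "\<lambda>k. Im (\<xi> k)"]
        unfolding form by (simp add: less_eq_complex_def cmod_power2 sum.distrib distrib_left)
    qed
  qed
  then show ?thesis
    using pd by (simp add: strongly_positive_definite_def G_def)
qed

section \<open>Sufficiency and necessity of the density condition\<close>

theorem proposition2p20:
  fixes \<Lambda> :: "nat \<Rightarrow> real" and r :: real
    and X :: "nat \<Rightarrow> real ^ 3" and f :: "real ^ 3 \<Rightarrow> complex"
  assumes "r > 0"
    and "\<And>k. X k = vector [0, 0, \<Lambda> k]"
    and "\<And>x. f x = complex_of_real (Omega3 (r * norm x))"
  shows "(separation \<Lambda> > 0 \<and> upper_density \<Lambda> < ereal (r / pi)
           \<longrightarrow> strongly_positive_definite X f) \<and>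
         (strongly_positive_definite X f
           \<longrightarrow> separation \<Lambda> > 0 \<and> upper_density \<Lambda> \<le> ereal (r / pi))"
proof -
  define s where "s = r / pi"
  define \<mu> where "\<mu> k = s * \<Lambda> k" for k
  have s: "s > 0"
    using assms(1) by (simp add: s_def)
  have spd_iff: "strongly_positive_definite X f \<longleftrightarrow>
    (\<exists>c>0. \<forall>(m::nat) x :: nat \<Rightarrow> real. c * (\<Sum>k<m. (x k)\<^sup>2) \<le>
       (\<Sum>k<m. \<Sum>j<m. x k * x j * sincpi (\<mu> k - \<mu> j)))"
    using strongly_positive_definite_sinc_iff[OF assms] by (simp add: \<mu>_def s_def)
  have interval: "{k. \<mu> k \<in> {a..a + t}} = {k. \<Lambda> k \<in> {a / s..a / s + t / s}}" for a t
    using s by (auto simp: \<mu>_def field_simps)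
  have "strongly_positive_definite X f"
    if sep: "separation \<Lambda> > 0" and dens: "upper_density \<Lambda> < ereal s"
  proof -
    obtain D where D: "upper_density \<Lambda> = ereal D"
      "((\<lambda>\<rho>. real (count_points \<Lambda> \<rho>) / \<rho>) \<longlongrightarrow> D) at_top"
      using upper_density_limit[OF sep] by blast
    have "\<forall>\<^sub>F \<rho> in at_top. real (count_points \<Lambda> \<rho>) / \<rho> < s"
      using D dens by (intro order_tendstoD(2)) auto
    \<comment> \<open>Only lengths \<open>L / s\<close> with integral \<open>L\<close> are tried,
      since after rescaling these are intervals of integer length \<open>L\<close> with fewer than
      \<open>L\<close> points.\<close>
    moreover have "filterlim (\<lambda>L. real L / s) at_top sequentially"
      using filterlim_tendsto_pos_mult_at_top[OF tendsto_const[of "1 / s"] _ filterlim_real_sequentially] s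
      by simp
    ultimately have "\<forall>\<^sub>F L in sequentially. real (count_points \<Lambda> (real L / s)) / (real L / s) < s"
      by (rule eventually_compose_filterlim)
    then have "\<forall>\<^sub>F L in sequentially. real (count_points \<Lambda> (real L / s)) / (real L / s) < s \<and> L \<ge> 1"
      using eventually_ge_at_top by (rule eventually_conj)
    then obtain L where L: "real (count_points \<Lambda> (real L / s)) / (real L / s) < s" "L \<ge> 1"
      using eventually_happens' sequentially_bot by blast
    then have count: "count_points \<Lambda> (real L / s) < L"
      using s by (simp add: field_simps)
    have ws: "well_spaced L (s * separation \<Lambda>) m \<mu>" for m
      unfolding well_spaced_def
    proof (intro conjI allI impI)
      fix a
      have "finite {k. \<mu> k \<in> {a..a + real L}}"
        unfolding interval by (rule finite_points_in_interval[OF sep])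
      then have "card {k \<in> {..<m}. \<mu> k \<in> {a..a + real L}} \<le> card {k. \<mu> k \<in> {a..a + real L}}"
        by (intro card_mono) auto
      also have "\<dots> \<le> count_points \<Lambda> (real L / s)"
        unfolding interval by (rule card_le_count_points[OF sep])
      finally show "card {k \<in> {..<m}. \<mu> k \<in> {a..a + real L}} < L"
        using count by linarith
    next
      fix i j :: nat assume "i \<noteq> j"
      have "s * separation \<Lambda> \<le> s * \<bar>\<Lambda> i - \<Lambda> j\<bar>"
        using s separation_le[OF \<open>i \<noteq> j\<close>] by simp
      also have "\<dots> = \<bar>\<mu> i - \<mu> j\<bar>"
        using s by (simp add: \<mu>_def abs_mult flip: right_diff_distrib)
      finally show "s * separation \<Lambda> \<le> \<bar>\<mu> i - \<mu> j\<bar>" .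
    qed
    obtain K where K: "K > 0" "\<forall>m \<mu> \<xi>. well_spaced L (s * separation \<Lambda>) m \<mu> \<longrightarrow>
        (\<Sum>k<m. (\<xi> k)\<^sup>2) \<le> K * (\<Sum>i<m. \<Sum>j<m. \<xi> i * \<xi> j * sincpi (\<mu> i - \<mu> j))"
      using gram_lower_bound[OF L(2), of "s * separation \<Lambda>"] s sep by auto
    have "1 / K * (\<Sum>k<m. (x k)\<^sup>2) \<le> (\<Sum>k<m. \<Sum>j<m. x k * x j * sincpi (\<mu> k - \<mu> j))" for m x
      using K(2)[rule_format, OF ws, where \<xi> = x] K(1) by (simp add: field_simps)
    then show ?thesis
      unfolding spd_iff using K(1) by (intro exI[of _ "1 / K"]) auto
  qed
  moreover have "separation \<Lambda> > 0 \<and> upper_density \<Lambda> \<le> ereal s"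
    if spd: "strongly_positive_definite X f"
  proof -
    obtain c where c: "c > 0" and low: "\<forall>(m::nat) x :: nat \<Rightarrow> real. c * (\<Sum>k<m. (x k)\<^sup>2) \<le>
       (\<Sum>k<m. \<Sum>j<m. x k * x j * sincpi (\<mu> k - \<mu> j))"
      using spd unfolding spd_iff by blast
    \<comment> \<open>The bound passes from initial segments to arbitrary finite index sets by
      padding with zeros.\<close>
    have lower: "c * (\<Sum>i\<in>I. (x i)\<^sup>2) \<le> (\<Sum>i\<in>I. \<Sum>j\<in>I. x i * x j * sincpi (\<mu> i - \<mu> j))"
      if "finite I" for I and x :: "nat \<Rightarrow> real"
    proof -
      obtain m where m: "I \<subseteq> {..<m}"
        using \<open>finite I\<close> finite_nat_iff_bounded by blast
      define y where "y i = (if i \<in> I then x i else 0)" for i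
      have *: "(\<Sum>i<m. F i) = (\<Sum>i\<in>I. F i)" if "\<And>i. i \<notin> I \<Longrightarrow> F i = 0" for F :: "nat \<Rightarrow> real"
        using m that by (intro sum.mono_neutral_right) auto
      have "(\<Sum>i<m. (y i)\<^sup>2) = (\<Sum>i\<in>I. (x i)\<^sup>2)"
        by (subst *) (auto simp: y_def intro: sum.cong)
      moreover have "(\<Sum>i<m. \<Sum>j<m. y i * y j * sincpi (\<mu> i - \<mu> j)) =
          (\<Sum>i\<in>I. \<Sum>j<m. y i * y j * sincpi (\<mu> i - \<mu> j))"
        by (rule *) (simp add: y_def)
      moreover have "\<dots> = (\<Sum>i\<in>I. \<Sum>j\<in>I. y i * y j * sincpi (\<mu> i - \<mu> j))"
        by (intro sum.cong refl *) (simp add: y_def)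
      moreover have "\<dots> = (\<Sum>i\<in>I. \<Sum>j\<in>I. x i * x j * sincpi (\<mu> i - \<mu> j))"
        by (intro sum.cong refl) (simp add: y_def)
      ultimately show ?thesis
        using low[rule_format, where m = m and x = y] by simp
    qed
    have "sqrt (6 * c) / pi / s \<le> \<bar>\<Lambda> k - \<Lambda> j\<bar>" if "k \<noteq> j" for k j
    proof -
      \<comment> \<open>The test vector with entries 1 and -1 on two points shows that close points
        would make the form too small.\<close>
      have "2 * c \<le> 2 - 2 * sincpi (\<mu> k - \<mu> j)"
        using lower[of "{k, j}" "\<lambda>i. if i = k then 1 else - 1"] that
        by (simp add: sincpi_commute[of "\<mu> j" "\<mu> k"])
      then have "6 * c \<le> (pi * (\<mu> k - \<mu> j))\<^sup>2"
        using sincpi_ge[of "\<mu> k - \<mu> j"] by simp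
      then have "sqrt (6 * c) \<le> \<bar>pi * (\<mu> k - \<mu> j)\<bar>"
        using real_sqrt_le_mono by fastforce
      also have "\<dots> = pi * s * \<bar>\<Lambda> k - \<Lambda> j\<bar>"
        using s by (simp add: \<mu>_def abs_mult flip: right_diff_distrib)
      finally show ?thesis
        using s by (simp add: field_simps)
    qed
    then have "sqrt (6 * c) / pi / s \<le> separation \<Lambda>"
      by (rule separation_ge)
    moreover have "sqrt (6 * c) / pi / s > 0"
      using c s by simp
    ultimately have sep: "separation \<Lambda> > 0" by linarith
    obtain D where D: "upper_density \<Lambda> = ereal D"
      "((\<lambda>\<rho>. real (count_points \<Lambda> \<rho>) / \<rho>) \<longlongrightarrow> D) at_top"
      using upper_density_limit[OF sep] by blast
    have "\<forall>\<eta>. 0 < \<eta> \<longrightarrow> \<eta> < 1 \<longrightarrow> D * (1 - \<eta>) \<le> s"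
    proof (intro allI impI)
      fix \<eta> :: real assume \<eta>: "\<eta> > 0" "\<eta> < 1"
      obtain B where B: "\<forall>I a \<rho>. finite I \<longrightarrow> \<mu> ` I \<subseteq> {a..a + \<rho>} \<longrightarrow> 0 \<le> \<rho> \<longrightarrow>
          (\<forall>x. c * (\<Sum>i\<in>I. (x i)\<^sup>2) \<le> (\<Sum>i\<in>I. \<Sum>j\<in>I. x i * x j * sincpi (\<mu> i - \<mu> j))) \<longrightarrow>
          real (card I) * (1 - \<eta>) \<le> \<rho> + B"
        using card_interval_le_of_gram_lower_bound[OF c \<eta>(1), of \<mu>] by blast
      have le: "real (count_points \<Lambda> \<rho>) / \<rho> * (1 - \<eta>) \<le> s + B / \<rho>" if \<rho>: "\<rho> > 0" for \<rho>
      proof -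
        define M where "M = (s * \<rho> + B) / (1 - \<eta>)"
        have card_le: "real (card {k. \<Lambda> k \<in> {a..a + \<rho>}}) \<le> M" for a
        proof -
          define I where "I = {k. \<Lambda> k \<in> {a..a + \<rho>}}"
          have fin: "finite I"
            unfolding I_def by (rule finite_points_in_interval(1)[OF sep])
          have "I = {k. \<mu> k \<in> {s * a..s * a + s * \<rho>}}"
            unfolding interval I_def using s by simp
          then have sub: "\<mu> ` I \<subseteq> {s * a..s * a + s * \<rho>}"
            by blast
          have "0 \<le> s * \<rho>"
            using s \<rho> by simp
          from B[rule_format, OF fin sub this lower[OF fin]]
          have "real (card {k. \<Lambda> k \<in> {a..a + \<rho>}}) * (1 - \<eta>) \<le> s * \<rho> + B"
            unfolding I_def .
          then show ?thesis
            using \<eta> by (simp add: M_def field_simps)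
        qed
        \<comment> \<open>The counts are integers, so the real bound \<open>M\<close> may be rounded
          down.\<close>
        have "count_points \<Lambda> \<rho> \<le> nat \<lfloor>M\<rfloor>"
          using card_le by (intro count_points_le[OF sep]) (simp add: le_nat_floor)
        moreover have "M \<ge> 0"
          using card_le[of 0] by (rule order_trans[rotated]) simp
        ultimately have "real (count_points \<Lambda> \<rho>) \<le> M"
          by linarith
        then have "real (count_points \<Lambda> \<rho>) * (1 - \<eta>) \<le> s * \<rho> + B"
          using \<eta> by (simp add: M_def pos_le_divide_eq)
        then have "real (count_points \<Lambda> \<rho>) * (1 - \<eta>) / \<rho> \<le> (s * \<rho> + B) / \<rho>"
          using \<rho> by (intro divide_right_mono) auto
        then show ?thesis
          using \<rho> by (simp add: add_divide_distrib)
      qed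
      have "((\<lambda>\<rho>. s + B / \<rho>) \<longlongrightarrow> s + 0) at_top"
        by (rule tendsto_add[OF tendsto_const real_tendsto_divide_at_top[OF tendsto_const filterlim_ident]])
      moreover have "((\<lambda>\<rho>. real (count_points \<Lambda> \<rho>) / \<rho> * (1 - \<eta>)) \<longlongrightarrow> D * (1 - \<eta>)) at_top"
        by (rule tendsto_mult[OF D(2) tendsto_const])
      ultimately have "D * (1 - \<eta>) \<le> s + 0"
      proof (rule tendsto_le[rotated])
        show "\<forall>\<^sub>F \<rho> in at_top. real (count_points \<Lambda> \<rho>) / \<rho> * (1 - \<eta>) \<le> s + B / \<rho>"
          using eventually_gt_at_top[of 0] by eventually_elim (rule le)
      qed simp
      then show "D * (1 - \<eta>) \<le> s" by simp
    qed
    then have "D \<le> s"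
    proof (rule contrapos_pp)
      assume "\<not> D \<le> s"
      then show "\<not> (\<forall>\<eta>. 0 < \<eta> \<longrightarrow> \<eta> < 1 \<longrightarrow> D * (1 - \<eta>) \<le> s)"
        \<comment> \<open>With this \<open>\<eta>\<close> the product
          \<open>D * (1 - \<eta>)\<close> is the midpoint of \<open>D\<close> and \<open>s\<close>,
          which exceeds \<open>s\<close>.\<close>
        using s by (intro notI, elim allE[of _ "(D - s) / (2 * D)"]) (simp add: field_simps)
    qed
    with sep D(1) show ?thesis by simp
  qed
  ultimately show ?thesis
    unfolding s_def [symmetric] by blast
qed

end
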